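(* Let $\mathcal S=((x_n,r_n))_{n\ge1}$ be a system with $x_n\in(0,1)^d$ for all $n$, such that $\limsup_{n\to\infty}B(x_n,r_n)=(0,1)^d$ and $\mathcal S$ satisfies conditions $\mathcal C_1$ and $\mathcal C_2$. Let $\Omega$ be a non-empty compact subset of $(0,1)^d$ whose interior has closure $\Omega$. Let $E\subset\Omega$ and let $f:(0,1)^d\to[1,\infty)$ be a function whose restriction to $\Omega\setminus E$ is continuous. For $A\subset(0,1)^d$ set $\mathcal L(A,f)=\{x\in A:\delta_x\ge f(x)\}$ and $\widetilde{\mathcal L}(A,f)=\{x\in A:\delta_x=f(x)\}$. If $\dim_{\mathcal H}E<\dfrac{d}{\inf\{f(x):x\in\Omega\setminus E\}}$, then $$\dim_{\mathcal H}\mathcal L(\Omega\setminus E,f)=\dim_{\mathcal H}\widetilde{\mathcal L}(\Omega\setminus E,f)=\frac{d}{\inf\{f(x):x\in\Omega\setminus E\}}.$$ If moreover $\dim_{\mathcal H}E<\dfrac{d}{\sup\{f(x):x\in\Omega\setminus E\}}$, then $\mathcal L(\Omega\setminus E,f)$ and $\widetilde{\mathcal L}(\Omega\setminus E,f)$ are dense in $\Omega$.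
   Context: Work in $\mathbb R^d$ ($d\ge1$) with the $L^\infty$ norm $\|\cdot\|$; $B(x,r)=\{y:\|y-x\|\le r\}$ and $|A|$ denotes the diameter of a set $A$; $\dim_{\mathcal H}$ is Hausdorff dimension; $[y]$ is the integer part of $y$. A system is a sequence $\mathcal S=((x_n,r_n))_{n\ge1}$ with $x_n\in[0,1]^d$ and $(r_n)$ a non-increasing sequence of positive reals tending to $0$; we write $(x,r)\in\mathcal S$ if $(x,r)=(x_n,r_n)$ for some $n$. For $\delta>0$, $\mathcal L_\delta=\{x\in[0,1]^d:\|x-x_n\|\le r_n^\delta$ for infinitely many $n\}$, and the approximation rate of $x$ is $\delta_x=\sup\{\delta>0:x\in\mathcal L_\delta\}$ (with $\sup\emptyset=0$). Irreducible subsystem: $((y_n,\rho_n))_{n\ge1}$ is the subsequence of $((x_n,r_n))$ consisting of those indices $n$ with $n=\min\{p\ge1:x_p=x_n\}$. For $j\ge0$, $\mathcal T_j=\{n:2^{-(j+1)}<\rho_n\le2^{-j}\}$. Condition $\mathcal C_1$: there is a non-decreasing sequence of positive integers $(N_j)_{j\ge0}$ with $\lim_{j\to\infty}(\log_2N_j)/j=0$ such that for every $j\ge1$, $\mathcal T_j$ can be decomposed into at most $N_j$ pairwise disjoint subsets $\mathcal T_{j,1},\dots,\mathcal T_{j,N_j}$ such that for each $i$ the balls $B(y_n,\rho_n)$, $n\in\mathcal T_{j,i}$, are pairwise disjoint. Given such $(N_j)$, let $\psi:\mathbb R_+\to\mathbb R_+$ be a continuous function with $\psi(0)=0$ and $N_j=2^{dj\psi(2^{-j})}$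 for all $j\ge1$. $\Phi$ is the set of functions $\varphi:\mathbb R_+\to\mathbb R_+$ that are non-decreasing, continuous, with $\varphi(0)=0$, such that $r\mapsto r^{-\varphi(r)}$ is decreasing and tends to $+\infty$ as $r\to0^+$, and such that for all $\alpha,\beta>0$ the map $r\mapsto r^{\alpha-\beta\varphi(r)}$ is increasing in a neighbourhood of $0$. For $\varphi\in\Phi$ and $j\ge1$, $\gamma(j)=\max\{k\in\mathbb N: N_k2^{dk}\le 2^{-dj\varphi(2^{-j})}2^{dj}\}$. $\mathcal G_j$ is the set of dyadic subcubes of $[0,1]^d$ of side $2^{-j}$, $\mathcal G_*=\bigcup_{j\ge1}\mathcal G_j$, and for $I\in\mathcal G_*$, $g(I)=-\log_2|I|$ is its generation. Property $\mathcal P(V,\delta)$ (for $V\in\mathcal G_*$, $\delta>1$, relative to fixed $\varphi$ and $(N_j)$): there exist $x(V)\in V$ and $r(V)>0$ with $(x(V),r(V))\in\mathcal S$, $2^{-g(V)-1}\le r(V)<2^{-g(V)}$, and $B(x(V),r(V)^\delta)\cap\{x_p:\gamma(g(V))\le-\log_2r_p<[\delta(g(V)+1)]+4\}=\{x(V)\}$. For a dyadic cube $U$, $j\ge g(U)$, $\delta>1$: $\mathcal Q(U,j,\delta)=\{V\in\mathcal G_j:V\subset U,\ \mathcal P(V,\delta)\text{ holds}\}$. Condition $\mathcal C_2$: $\mathcal S$ satisfies $\mathcal C_1$ and there exist $\varphi\in\Phi$, a sequence $(N_j)$ as in $\mathcal C_1$, a continuous function $\kappa:(1,\infty)\to(0,1]$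 and a dense subset $\Delta\subset(1,\infty)$ such that for every $\delta\in\Delta$ and every dyadic cube $U\subset[0,1]^d$ there are infinitely many integers $j\ge g(U)$ with $\#\mathcal Q(U,j,\delta)\ge\kappa(\delta)2^{d(j-g(U))}$. *)

theory Defs
  imports "HOL-Analysis.Analysis"
begin

definition linf_dist :: "real^'d \<Rightarrow> real^'d \<Rightarrow> real" where
  "linf_dist x y = Max (range (\<lambda>i. \<bar>x$i - y$i\<bar>))"

definition ball_inf :: "real^'d \<Rightarrow> real \<Rightarrow> (real^'d) set" where
  "ball_inf c \<rho> = {y. linf_dist c y \<le> \<rho>}"

definition diam_inf :: "(real^'d) set \<Rightarrow> real" where
  "diam_inf A = (if A = {} then 0 else Sup {linf_dist x y | x y. x \<in> A \<and> y \<in> A})"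

definition closed_cube01 :: "(real^'d) set" where
  "closed_cube01 = {y. \<forall>i. 0 \<le> y$i \<and> y$i \<le> 1}"

definition open_cube01 :: "(real^'d) set" where
  "open_cube01 = {y. \<forall>i. 0 < y$i \<and> y$i < 1}"

definition hausdorff_pre :: "real \<Rightarrow> real \<Rightarrow> (real^'d) set \<Rightarrow> ennreal" where
  "hausdorff_pre s \<delta> A =
     (INF U \<in> {U :: nat \<Rightarrow> (real^'d) set. A \<subseteq> \<Union>(range U) \<and>
                 (\<forall>i. bounded (U i) \<and> diam_inf (U i) \<le> \<delta>)}.
        (\<Sum>i. ennreal (diam_inf (U i) powr s)))"

definition hausdorff_measure :: "real \<Rightarrow> (real^'d) set \<Rightarrow> ennreal" where
  "hausdorff_measure s A = (SUP \<delta> \<in> {0<..}. hausdorff_pre s \<delta> A)"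

definition hdim :: "(real^'d) set \<Rightarrow> real" where
  "hdim A = Inf {s::real. 0 < s \<and> hausdorff_measure s A = 0}"

section \<open>Systems and approximation rates (indices shifted: n \<ge> 1 becomes n \<ge> 0)\<close>

definition is_system :: "(nat \<Rightarrow> real^'d) \<Rightarrow> (nat \<Rightarrow> real) \<Rightarrow> bool" where
  "is_system x r \<longleftrightarrow> (\<forall>n. x n \<in> closed_cube01) \<and> (\<forall>n. 0 < r n) \<and> decseq r \<and> r \<longlonglongrightarrow> 0"

definition L_set :: "(nat \<Rightarrow> real^'d) \<Rightarrow> (nat \<Rightarrow> real) \<Rightarrow> real \<Rightarrow> (real^'d) set" where
  "L_set x r \<delta> = {y \<in> closed_cube01. infinite {n. linf_dist y (x n) \<le> r n powr \<delta>}}"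

definition approx_rate :: "(nat \<Rightarrow> real^'d) \<Rightarrow> (nat \<Rightarrow> real) \<Rightarrow> real^'d \<Rightarrow> ereal" where
  "approx_rate x r y = Sup (insert 0 (ereal ` {\<delta>. 0 < \<delta> \<and> y \<in> L_set x r \<delta>}))"

definition Lf :: "(nat \<Rightarrow> real^'d) \<Rightarrow> (nat \<Rightarrow> real) \<Rightarrow> (real^'d) set \<Rightarrow> (real^'d \<Rightarrow> real) \<Rightarrow> (real^'d) set" where
  "Lf x r A f = {y \<in> A. ereal (f y) \<le> approx_rate x r y}"

definition Lf_exact :: "(nat \<Rightarrow> real^'d) \<Rightarrow> (nat \<Rightarrow> real) \<Rightarrow> (real^'d) set \<Rightarrow> (real^'d \<Rightarrow> real) \<Rightarrow> (real^'d) set" where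
  "Lf_exact x r A f = {y \<in> A. approx_rate x r y = ereal (f y)}"

text \<open>Indices of the irreducible subsystem: first occurrences of a point.\<close>
definition first_occ :: "(nat \<Rightarrow> real^'d) \<Rightarrow> nat \<Rightarrow> bool" where
  "first_occ x n \<longleftrightarrow> (\<forall>p<n. x p \<noteq> x n)"

definition T_set :: "(nat \<Rightarrow> real^'d) \<Rightarrow> (nat \<Rightarrow> real) \<Rightarrow> nat \<Rightarrow> nat set" where
  "T_set x r j = {n. first_occ x n \<and> 2 powr (-(real j + 1)) < r n \<and> r n \<le> 2 powr (- real j)}"

definition C1_seq :: "(nat \<Rightarrow> real^'d) \<Rightarrow> (nat \<Rightarrow> real) \<Rightarrow> (nat \<Rightarrow> nat) \<Rightarrow> bool" where
  "C1_seq x r N \<longleftrightarrow> (\<forall>j. 0 < N j) \<and> mono N \<and>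
     ((\<lambda>j. log 2 (real (N j)) / real j) \<longlonglongrightarrow> 0) \<and>
     (\<forall>j\<ge>1. \<exists>P :: nat \<Rightarrow> nat set.
        T_set x r j = (\<Union>i<N j. P i) \<and>
        (\<forall>i<N j. \<forall>i'<N j. i \<noteq> i' \<longrightarrow> P i \<inter> P i' = {}) \<and>
        (\<forall>i<N j. \<forall>n\<in>P i. \<forall>m\<in>P i. n \<noteq> m \<longrightarrow>
            ball_inf (x n) (r n) \<inter> ball_inf (x m) (r m) = {}))"

definition C1 :: "(nat \<Rightarrow> real^'d) \<Rightarrow> (nat \<Rightarrow> real) \<Rightarrow> bool" where
  "C1 x r \<longleftrightarrow> (\<exists>N. C1_seq x r N)"

definition In_Phi :: "(real \<Rightarrow> real) \<Rightarrow> bool" where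
  "In_Phi \<phi> \<longleftrightarrow> mono_on {0..} \<phi> \<and> continuous_on {0..} \<phi> \<and> \<phi> 0 = 0 \<and>
     (\<forall>t\<ge>0. 0 \<le> \<phi> t) \<and>
     (\<forall>a b. 0 < a \<and> a < b \<longrightarrow> b powr (- \<phi> b) < a powr (- \<phi> a)) \<and>
     filterlim (\<lambda>t. t powr (- \<phi> t)) at_top (at_right 0) \<and>
     (\<forall>\<alpha>>0. \<forall>\<beta>>0. \<exists>\<eta>>0. \<forall>a b. 0 < a \<and> a < b \<and> b < \<eta> \<longrightarrow>
          a powr (\<alpha> - \<beta> * \<phi> a) < b powr (\<alpha> - \<beta> * \<phi> b))"

definition gamma :: "nat \<Rightarrow> (nat \<Rightarrow> nat) \<Rightarrow> (real \<Rightarrow> real) \<Rightarrow> nat \<Rightarrow> nat" where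
  "gamma d N \<phi> j = (GREATEST k::nat. real (N k) * 2 powr (real d * real k)
        \<le> 2 powr (- real d * real j * \<phi> (2 powr (- real j))) * 2 powr (real d * real j))"

definition dcube :: "nat \<Rightarrow> nat^'d \<Rightarrow> (real^'d) set" where
  "dcube j k = {y. \<forall>i. real (k$i) / 2^j \<le> y$i \<and> y$i < (real (k$i) + 1) / 2^j}"

definition valid_dyadic :: "nat \<Rightarrow> nat^'d \<Rightarrow> bool" where
  "valid_dyadic j k \<longleftrightarrow> (\<forall>i. k$i < 2^j)"

definition P_prop :: "(nat \<Rightarrow> real^'d) \<Rightarrow> (nat \<Rightarrow> real) \<Rightarrow> (nat \<Rightarrow> nat) \<Rightarrow> (real \<Rightarrow> real)
    \<Rightarrow> nat \<Rightarrow> nat^'d \<Rightarrow> real \<Rightarrow> bool" where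
  "P_prop x r N \<phi> j k \<delta> \<longleftrightarrow> (\<exists>n. x n \<in> dcube j k \<and>
      2 powr (-(real j + 1)) \<le> r n \<and> r n < 2 powr (- real j) \<and>
      ball_inf (x n) (r n powr \<delta>) \<inter>
        {x p | p. real (gamma CARD('d) N \<phi> j) \<le> - log 2 (r p) \<and>
                  - log 2 (r p) < real_of_int \<lfloor>\<delta> * (real j + 1)\<rfloor> + 4}
      = {x n})"

definition Q_set :: "(nat \<Rightarrow> real^'d) \<Rightarrow> (nat \<Rightarrow> real) \<Rightarrow> (nat \<Rightarrow> nat) \<Rightarrow> (real \<Rightarrow> real)
    \<Rightarrow> nat \<Rightarrow> nat^'d \<Rightarrow> nat \<Rightarrow> real \<Rightarrow> (nat^'d) set" where
  "Q_set x r N \<phi> gU kU j \<delta> =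
     {k. valid_dyadic j k \<and> dcube j k \<subseteq> dcube gU kU \<and> P_prop x r N \<phi> j k \<delta>}"

definition C2 :: "(nat \<Rightarrow> real^'d) \<Rightarrow> (nat \<Rightarrow> real) \<Rightarrow> bool" where
  "C2 x r \<longleftrightarrow> (\<exists>\<phi> N (\<kappa>::real \<Rightarrow> real) (\<Delta>::real set).
     In_Phi \<phi> \<and> C1_seq x r N \<and>
     continuous_on {1<..} \<kappa> \<and> (\<forall>\<delta>>1. 0 < \<kappa> \<delta> \<and> \<kappa> \<delta> \<le> 1) \<and>
     \<Delta> \<subseteq> {1<..} \<and> {1<..} \<subseteq> closure \<Delta> \<and>
     (\<forall>\<delta>\<in>\<Delta>. \<forall>gU (kU::nat^'d). gU \<ge> 1 \<and> valid_dyadic gU kU \<longrightarrow>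
        infinite {j. gU \<le> j \<and>
          real (card (Q_set x r N \<phi> gU kU j \<delta>)) \<ge> \<kappa> \<delta> * 2 powr (real CARD('d) * (real j - real gU))}))"

end

theory Submission
  imports Defs "HOL-Real_Asymp.Real_Asymp"
begin

text \<open>
  Upper bound: points with rate at least \<open>h\<close> lie in \<open>L_set x r \<delta>\<close> for every \<open>\<delta> < h\<close>, and by \<open>C1\<close> the
  balls of radius \<open>r\<^sub>n\<^sup>\<delta>\<close> around the irreducible subsystem cover this set economically.

  Lower bound: let \<open>W\<close> be an open set on which \<open>f < M\<close> off \<open>E\<close>, and let \<open>s < d / M\<close>. No mass
  distribution is needed: assuming that \<open>Lf_exact\<close>, \<open>E\<close> and all the points \<open>x\<^sub>n\<close> are together covered
  by sets of diameter at most \<open>a\<^sub>i\<close> with \<open>\<Sum> a\<^sub>i\<^sup>s\<close> tiny, one constructs a single nested sequence of dyadic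
  cubes whose limit point is missed by the whole cover and has rate exactly \<open>f\<close>, a contradiction.
  The invariant is that the sum of \<open>a\<^sub>i\<^sup>s\<close> over the covering sets meeting the current cube is at most
  \<open>c\<^sub>n\<close> times the side length to the power \<open>s\<close>. To refine a cube one picks \<open>\<delta> \<in> \<Delta>\<close> close to a
  value of \<open>f\<close> in it and, among the many subcubes given by \<open>C2\<close>, discards those close to an \<open>x\<^sub>p\<close> of
  intermediate radius, those meeting a large covering set, and those charged too heavily by small ones;
  a count shows that some subcube survives. The new cube lies close to the point \<open>x(V)\<close> of that subcube
  \<open>V\<close>, which keeps the rate at least \<open>\<delta>\<close>; the discarded cubes and the isolation part of \<open>P_prop\<close>
  keep it from being larger.
\<close>

section \<open>The sup-norm metric and coverings of small total size\<close>

lemma linf_dist_le_iff: "linf_dist x y \<le> \<rho> \<longleftrightarrow> (\<forall>i. \<bar>x$i - y$i\<bar> \<le> \<rho>)"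
  unfolding linf_dist_def by (subst Max_le_iff) auto

lemma component_le_linf_dist: "\<bar>x$i - y$i\<bar> \<le> linf_dist x y"
  using linf_dist_le_iff by blast

lemma linf_dist_nonneg: "0 \<le> linf_dist x y"
  using component_le_linf_dist[of x undefined y] by linarith

lemma linf_dist_commute: "linf_dist x y = linf_dist y x"
  unfolding linf_dist_def by (simp add: abs_minus_commute)

lemma linf_dist_triangle: "linf_dist x z \<le> linf_dist x y + linf_dist y z"
  unfolding linf_dist_le_iff
proof
  fix i
  show "\<bar>x$i - z$i\<bar> \<le> linf_dist x y + linf_dist y z"
    using component_le_linf_dist[of x i y] component_le_linf_dist[of y i z] by linarith
qed

lemma linf_dist_eq_0_iff: "linf_dist x y = 0 \<longleftrightarrow> x = y"
proof
  assume "linf_dist x y = 0"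
  then have "\<And>i. \<bar>x$i - y$i\<bar> \<le> 0" using component_le_linf_dist[of x _ y] by simp
  then show "x = y" by (simp add: vec_eq_iff)
qed (use linf_dist_le_iff[of x y 0] linf_dist_nonneg[of x y] in auto)

lemma norm_le_linf_dist:
  fixes x y :: "real^'d"
  shows "norm (x - y) \<le> real CARD('d) * linf_dist x y"
proof -
  have "norm (x - y) \<le> (\<Sum>i\<in>UNIV. \<bar>x$i - y$i\<bar>)"
    using norm_le_l1_cart[of "x - y"] by simp
  also have "\<dots> \<le> (\<Sum>i\<in>(UNIV::'d set). linf_dist x y)"
    by (intro sum_mono component_le_linf_dist)
  finally show ?thesis by simp
qed

lemma linf_dist_le_norm: "linf_dist x y \<le> norm (x - y)"
  unfolding linf_dist_le_iff using component_le_norm_cart[of "x - y"] by simp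

lemma bounded_linf_dist:
  assumes "\<And>y z. y \<in> A \<Longrightarrow> z \<in> A \<Longrightarrow> linf_dist y z \<le> a"
  shows "bounded (A :: (real^'d) set)"
proof (cases "A = {}")
  case False
  then obtain c where c: "c \<in> A" by blast
  have "dist c y \<le> real CARD('d) * a" if "y \<in> A" for y
    using norm_le_linf_dist[of c y] assms[OF c that]
    by (smt (verit) dist_norm mult_left_mono of_nat_0_le_iff)
  then show ?thesis unfolding bounded_def by blast
qed simp

text \<open>Boundedness is what makes the real supremum in \<open>diam_inf\<close> an actual upper
  bound.\<close>

lemma linf_dist_le_diam_inf:
  assumes "bounded (A :: (real^'d) set)" "y \<in> A" "z \<in> A"
  shows "linf_dist y z \<le> diam_inf A"
proof -
  obtain b where b: "\<And>y. y \<in> A \<Longrightarrow> norm y \<le> b"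
    using assms(1) unfolding bounded_iff by blast
  have "linf_dist u v \<le> 2 * b" if "u \<in> A" "v \<in> A" for u v
    using linf_dist_le_norm[of u v] norm_triangle_ineq4[of u v] b[OF that(1)] b[OF that(2)] by linarith
  then have "bdd_above {linf_dist x y | x y. x \<in> A \<and> y \<in> A}"
    by (intro bdd_aboveI[of _ "2 * b"]) auto
  then have "linf_dist y z \<le> Sup {linf_dist x y | x y. x \<in> A \<and> y \<in> A}"
    using assms(2,3) by (intro cSup_upper) auto
  then show ?thesis using assms(2) unfolding diam_inf_def by auto
qed

lemma diam_inf_le:
  assumes "\<And>y z. y \<in> A \<Longrightarrow> z \<in> A \<Longrightarrow> linf_dist y z \<le> a" "0 \<le> a"
  shows "diam_inf A \<le> a"
proof (cases "A = {}")
  case False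
  then obtain c where "c \<in> A" by blast
  then have "{linf_dist x y | x y. x \<in> A \<and> y \<in> A} \<noteq> {}" by blast
  then have "Sup {linf_dist x y | x y. x \<in> A \<and> y \<in> A} \<le> a"
    by (rule cSup_least) (use assms(1) in auto)
  then show ?thesis using False unfolding diam_inf_def by simp
qed (simp add: diam_inf_def assms(2))

lemma diam_inf_nonneg: "bounded A \<Longrightarrow> 0 \<le> diam_inf A"
  by (metis diam_inf_def dual_order.refl equals0I linf_dist_le_diam_inf linf_dist_nonneg order_trans)

text \<open>
  The sizes \<open>a i\<close> are positive even for singletons, whose diameter would contribute \<open>0 powr s = 0\<close>:
  a small weighted sum over the sets meeting a cube then really keeps every set away.
\<close>
definition null_covers :: "real \<Rightarrow> (real^'d) set \<Rightarrow> bool" where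
  "null_covers s A \<longleftrightarrow> (\<forall>\<epsilon>>0. \<exists>U a. A \<subseteq> \<Union>(range U) \<and>
     (\<forall>i::nat. 0 < a i \<and> (\<forall>y\<in>U i. \<forall>z\<in>U i. linf_dist y z \<le> a i)) \<and>
     summable (\<lambda>i. a i powr s) \<and> (\<Sum>i. a i powr s) < \<epsilon>)"

lemma powr_inverse_exponent: "0 < s \<Longrightarrow> 0 < v \<Longrightarrow> (v powr (1/s)) powr s = (v::real)"
  by (simp add: powr_powr)

text \<open>Sizes that vanish can be made positive at no cost: adding a geometric series of total
  \<open>\<epsilon>/2\<close> to the powers \<open>b i powr s\<close> keeps the sum below
  \<open>\<epsilon>\<close> and only enlarges the sizes.\<close>

lemma null_coversI:
  fixes A :: "(real^'d) set"
  assumes s: "0 < s"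
    and cov: "\<And>\<epsilon>. \<epsilon> > 0 \<Longrightarrow> \<exists>U b. A \<subseteq> \<Union>(range U) \<and>
     (\<forall>i::nat. 0 \<le> b i \<and> (\<forall>y\<in>U i. \<forall>z\<in>U i. linf_dist y z \<le> b i)) \<and>
     summable (\<lambda>i. b i powr s) \<and> (\<Sum>i. b i powr s) < \<epsilon>"
  shows "null_covers s A"
  unfolding null_covers_def
proof (intro allI impI)
  fix \<epsilon> :: real assume e: "\<epsilon> > 0"
  then have "\<epsilon>/2 > 0" by simp
  from cov[OF this] obtain U b where U: "A \<subseteq> \<Union>(range U)" "\<And>i::nat. 0 \<le> b i"
      "\<And>i y z. y \<in> U i \<Longrightarrow> z \<in> U i \<Longrightarrow> linf_dist y z \<le> b i"
      and S1: "summable (\<lambda>i. b i powr s)" and s1: "(\<Sum>i. b i powr s) < \<epsilon>/2" by blast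
  \<comment> \<open>The padding goes into the power and not into the size itself, so that its total
    does not depend on \<open>s\<close>.\<close>
  define a where "a i = (b i powr s + \<epsilon>/4 * (1/2)^i) powr (1/s)" for i
  have pos: "0 < b i powr s + \<epsilon>/4 * (1/2)^i" for i
    using e by (intro add_nonneg_pos) auto
  have as: "a i powr s = b i powr s + \<epsilon>/4 * (1/2)^i" for i
    unfolding a_def using powr_inverse_exponent[OF s pos] by simp
  have le: "b i \<le> a i" for i
  proof -
    have "b i = (b i powr s) powr (1/s)" using s U(2)[of i] by (simp add: powr_powr)
    also have "\<dots> \<le> a i" unfolding a_def using s e by (intro powr_mono2) auto
    finally show ?thesis .
  qed
  have S2: "summable (\<lambda>i. \<epsilon>/4 * (1/2::real)^i)" by (intro summable_mult summable_geometric) simp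
  have "(\<Sum>i. a i powr s) = (\<Sum>i. b i powr s) + (\<Sum>i. \<epsilon>/4 * (1/2)^i)"
    unfolding as using suminf_add[OF S1 S2] by simp
  also have "(\<Sum>i. \<epsilon>/4 * (1/2::real)^i) = \<epsilon>/2"
    by (subst suminf_mult) (auto simp: suminf_geometric)
  finally have "(\<Sum>i. a i powr s) < \<epsilon>" using s1 by simp
  moreover have "summable (\<lambda>i. a i powr s)" unfolding as by (intro summable_add S1 S2)
  moreover have "0 < a i" for i unfolding a_def using pos[of i] by auto
  moreover have "linf_dist y z \<le> a i" if "y \<in> U i" "z \<in> U i" for i y z
    using U(3)[OF that] le[of i] by linarith
  ultimately show "\<exists>U a. A \<subseteq> \<Union>(range U) \<and>
     (\<forall>i::nat. 0 < a i \<and> (\<forall>y\<in>U i. \<forall>z\<in>U i. linf_dist y z \<le> a i)) \<and>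
     summable (\<lambda>i. a i powr s) \<and> (\<Sum>i. a i powr s) < \<epsilon>"
    using U(1) by blast
qed

text \<open>Vanishing measure makes \<open>hausdorff_pre\<close> vanish at scale 1, which already
  gives the covers. Conversely, a small total forces every single size to be small, so
  \<open>null_covers\<close> need not record a scale.\<close>

lemma null_covers_iff_hausdorff_measure:
  fixes A :: "(real^'d) set"
  assumes s: "0 < s"
  shows "hausdorff_measure s A = 0 \<longleftrightarrow> null_covers s A"
proof
  assume H: "hausdorff_measure s A = 0"
  show "null_covers s A"
  proof (rule null_coversI[OF s])
    fix \<epsilon> :: real assume e: "\<epsilon> > 0"
    have "hausdorff_pre s 1 A \<le> hausdorff_measure s A"
      unfolding hausdorff_measure_def by (rule SUP_upper) simp
    then have "hausdorff_pre s 1 A < ennreal \<epsilon>" using H e by simp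
    then obtain U where U: "A \<subseteq> \<Union>(range U)" "\<And>i. bounded (U i)"
      and sm: "(\<Sum>i. ennreal (diam_inf (U i) powr s)) < ennreal \<epsilon>"
      unfolding hausdorff_pre_def INF_less_iff by auto
    have S1: "summable (\<lambda>i. diam_inf (U i) powr s)"
      using sm by (intro summable_suminf_not_top) (auto simp: top_unique)
    have "ennreal (\<Sum>i. diam_inf (U i) powr s) < ennreal \<epsilon>"
      using sm by (subst suminf_ennreal2[symmetric]) (auto intro: S1)
    then have s1: "(\<Sum>i. diam_inf (U i) powr s) < \<epsilon>"
      by (simp add: ennreal_less_iff suminf_nonneg S1)
    show "\<exists>U b. A \<subseteq> \<Union>(range U) \<and>
     (\<forall>i::nat. 0 \<le> b i \<and> (\<forall>y\<in>U i. \<forall>z\<in>U i. linf_dist y z \<le> b i)) \<and>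
     summable (\<lambda>i. b i powr s) \<and> (\<Sum>i. b i powr s) < \<epsilon>"
      using U(1) S1 s1 diam_inf_nonneg[OF U(2)] linf_dist_le_diam_inf[OF U(2)]
      by (intro exI[of _ U] exI[of _ "\<lambda>i. diam_inf (U i)"]) blast
  qed
next
  assume N: "null_covers s A"
  have "hausdorff_pre s \<delta> A \<le> ennreal e" if d: "\<delta> > 0" and e: "e > 0" for \<delta> e
  proof -
    \<comment> \<open>A total below \<open>\<delta> powr s\<close> bounds each \<open>a i\<close> by
      \<open>\<delta>\<close>, so the cover is admissible at scale \<open>\<delta>\<close>.\<close>
    have "min e (\<delta> powr s) > 0" using d e by simp
    then obtain U a where U: "A \<subseteq> \<Union>(range U)"
      "\<And>i. 0 < a i" "\<And>i y z. y \<in> U i \<Longrightarrow> z \<in> U i \<Longrightarrow> linf_dist y z \<le> a i"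
      and sm: "summable (\<lambda>i. a i powr s)" and lt: "(\<Sum>i. a i powr s) < min e (\<delta> powr s)"
      using N unfolding null_covers_def by meson
    have B: "bounded (U i)" for i using U(3) by (rule bounded_linf_dist)
    have di: "diam_inf (U i) \<le> a i" for i using U(2)[of i] by (intro diam_inf_le U(3)) auto
    have ai: "a i \<le> \<delta>" for i
    proof -
      have "a i powr s \<le> (\<Sum>i. a i powr s)"
        using sum_le_suminf[OF sm, of "{i}"] by simp
      then have "a i powr s \<le> \<delta> powr s" using lt by simp
      then show ?thesis using s U(2)[of i] d powr_less_mono2[of s \<delta> "a i"] by linarith
    qed
    have "hausdorff_pre s \<delta> A \<le> (\<Sum>i. ennreal (diam_inf (U i) powr s))"
      unfolding hausdorff_pre_def using U(1) B order_trans[OF di ai] by (intro INF_lower) auto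
    also have "\<dots> \<le> (\<Sum>i. ennreal (a i powr s))"
      using s by (intro suminf_le ennreal_leI powr_mono2 di diam_inf_nonneg B summableI) auto
    also have "\<dots> = ennreal (\<Sum>i. a i powr s)" by (intro suminf_ennreal2 sm) auto
    also have "\<dots> \<le> ennreal e" using lt by (intro ennreal_leI) simp
    finally show ?thesis .
  qed
  then have "hausdorff_pre s \<delta> A \<le> 0" if "\<delta> > 0" for \<delta>
    using that ennreal_le_epsilon[of 0 "hausdorff_pre s \<delta> A"] by simp
  then show "hausdorff_measure s A = 0"
    unfolding hausdorff_measure_def by (auto simp: SUP_eq_iff intro!: antisym SUP_least)
qed

lemma null_coversD:
  assumes "null_covers s A" "\<epsilon> > 0"
  obtains U :: "nat \<Rightarrow> (real^'d) set" and a where "A \<subseteq> \<Union>(range U)" "\<And>i. 0 < a i"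
    "\<And>i y z. y \<in> U i \<Longrightarrow> z \<in> U i \<Longrightarrow> linf_dist y z \<le> a i"
    "summable (\<lambda>i. a i powr s)" "(\<Sum>i. a i powr s) < \<epsilon>"
  using assms unfolding null_covers_def by meson

lemma null_covers_subset: "null_covers s B \<Longrightarrow> A \<subseteq> B \<Longrightarrow> null_covers s A"
  unfolding null_covers_def by (meson order_trans)

text \<open>When the total weight is below 1, every size is at most 1, and raising the exponent only
  decreases the weights.\<close>

lemma null_covers_mono:
  assumes N: "null_covers s A" and st: "0 < s" "s \<le> t"
  shows "null_covers t A"
  unfolding null_covers_def
proof (intro allI impI)
  fix \<epsilon> :: real assume "\<epsilon> > 0"
  then have "min \<epsilon> 1 > 0" by simp
  from N this obtain U a where U: "A \<subseteq> \<Union>(range U)" "\<And>i. 0 < a i"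
    "\<And>i y z. y \<in> U i \<Longrightarrow> z \<in> U i \<Longrightarrow> linf_dist y z \<le> a i"
    and sm: "summable (\<lambda>i. a i powr s)" and lt: "(\<Sum>i. a i powr s) < min \<epsilon> 1"
    by (rule null_coversD) blast
  have le: "a i powr t \<le> a i powr s" for i
  proof -
    have "a i powr s \<le> (\<Sum>i. a i powr s)" using sum_le_suminf[OF sm, of "{i}"] by simp
    then have "a i powr s < 1 powr s" using lt by simp
    then have "a i \<le> 1" using st(1) U(2)[of i]      using powr_less_mono2[of s 1 "a i"] by linarith
    then show ?thesis using st U(2)[of i] by (intro powr_mono') auto
  qed
  have sm': "summable (\<lambda>i. a i powr t)"
    using le by (intro summable_comparison_test[OF _ sm]) auto
  have "(\<Sum>i. a i powr t) < \<epsilon>" using suminf_le[OF le sm' sm] lt by linarith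
  with U sm' show "\<exists>U a. A \<subseteq> \<Union>(range U) \<and>
     (\<forall>i::nat. 0 < a i \<and> (\<forall>y\<in>U i. \<forall>z\<in>U i. linf_dist y z \<le> a i)) \<and>
     summable (\<lambda>i. a i powr t) \<and> (\<Sum>i. a i powr t) < \<epsilon>" by blast
qed

text \<open>Singletons of size 0 have weight \<open>0 powr s = 0\<close>. Adjoining all the centres
  to a set is therefore harmless, which lets the rate arguments assume that the point is not one of
  them.\<close>

lemma null_covers_range:
  fixes x :: "nat \<Rightarrow> real^'d"
  assumes s: "0 < s"
  shows "null_covers s (range x)"
proof (rule null_coversI[OF s])
  fix \<epsilon> :: real assume "\<epsilon> > 0"
  moreover have "range x \<subseteq> \<Union>(range (\<lambda>i. {x i}))" by auto
  ultimately show "\<exists>U b. range x \<subseteq> \<Union>(range U) \<and>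
     (\<forall>i::nat. 0 \<le> b i \<and> (\<forall>y\<in>U i. \<forall>z\<in>U i. linf_dist y z \<le> b i)) \<and>
     summable (\<lambda>i. b i powr s) \<and> (\<Sum>i. b i powr s) < \<epsilon>"
    by (intro exI[of _ "\<lambda>i. {x i}"] exI[of _ "\<lambda>_. 0"]) (simp add: linf_dist_le_iff)
qed

lemma sums_interleave:
  fixes f g :: "nat \<Rightarrow> real"
  assumes "f sums u" "g sums v"
  shows "(\<lambda>n. if even n then f (n div 2) else g ((n - 1) div 2)) sums (u + v)"
  using sums_if[OF assms(2,1)] by (simp add: add.commute)

text \<open>Two covers of total below \<open>\<epsilon>/2\<close> are interleaved along the even and
  the odd indices.\<close>

lemma null_covers_Un:
  fixes A B :: "(real^'d) set"
  assumes A: "null_covers s A" and B: "null_covers s B"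
  shows "null_covers s (A \<union> B)"
  unfolding null_covers_def
proof (intro allI impI)
  fix \<epsilon> :: real assume e: "\<epsilon> > 0"
  then have e2: "\<epsilon>/2 > 0" by simp
  obtain U a where U: "A \<subseteq> \<Union>(range U)" "\<And>i. 0 < a i"
    "\<And>i y z. y \<in> U i \<Longrightarrow> z \<in> U i \<Longrightarrow> linf_dist y z \<le> a i"
    and sm: "summable (\<lambda>i. a i powr s)" and lt: "(\<Sum>i. a i powr s) < \<epsilon>/2"
    by (rule null_coversD[OF A e2]) blast
  obtain V b where V: "B \<subseteq> \<Union>(range V)" "\<And>i. 0 < b i"
    "\<And>i y z. y \<in> V i \<Longrightarrow> z \<in> V i \<Longrightarrow> linf_dist y z \<le> b i"
    and smb: "summable (\<lambda>i. b i powr s)" and ltb: "(\<Sum>i. b i powr s) < \<epsilon>/2"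
    by (rule null_coversD[OF B e2]) blast
  define W where "W n = (if even n then U (n div 2) else V ((n - 1) div 2))" for n
  define c where "c n = (if even n then a (n div 2) else b ((n - 1) div 2))" for n
  have "(\<lambda>n. c n powr s) sums ((\<Sum>i. a i powr s) + (\<Sum>i. b i powr s))"
    using sums_interleave[OF summable_sums[OF sm] summable_sums[OF smb]]
    unfolding c_def if_distrib[of "\<lambda>v. v powr s"] .
  then have "summable (\<lambda>n. c n powr s)" "(\<Sum>n. c n powr s) < \<epsilon>"
    using lt ltb by (auto simp: sums_iff)
  moreover have "0 < c i" for i using U(2) V(2) by (simp add: c_def)
  moreover have "linf_dist y z \<le> c i" if "y \<in> W i" "z \<in> W i" for i y z
    using that U(3) V(3) unfolding c_def W_def by (auto split: if_splits)
  moreover have "A \<union> B \<subseteq> \<Union>(range W)"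
  proof -
    have "U i \<subseteq> \<Union>(range W)" for i
      by (rule Sup_upper) (rule image_eqI[of _ _ "2 * i"], auto simp: W_def)
    moreover have "V i \<subseteq> \<Union>(range W)" for i
      by (rule Sup_upper) (rule image_eqI[of _ _ "2 * i + 1"], auto simp: W_def)
    ultimately have "\<Union>(range U) \<subseteq> \<Union>(range W)" "\<Union>(range V) \<subseteq> \<Union>(range W)" by (auto simp only: UN_subset_iff)
    then show ?thesis using U(1) V(1) by (meson Un_least order_trans)
  qed
  ultimately show "\<exists>U a. A \<union> B \<subseteq> \<Union>(range U) \<and>
     (\<forall>i::nat. 0 < a i \<and> (\<forall>y\<in>U i. \<forall>z\<in>U i. linf_dist y z \<le> a i)) \<and>
     summable (\<lambda>i. a i powr s) \<and> (\<Sum>i. a i powr s) < \<epsilon>"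
    by (intro exI[of _ W] exI[of _ c]) blast
qed

section \<open>Counting dyadic cubes and the upper bound\<close>

text \<open>The closed counterpart of \<open>dcube\<close>: nested sequences of these cubes have a
  common point by compactness.\<close>

definition ccube :: "nat \<Rightarrow> nat^'d \<Rightarrow> (real^'d) set" where
  "ccube j k = {y. \<forall>i. real (k$i) / 2^j \<le> y$i \<and> y$i \<le> (real (k$i) + 1) / 2^j}"

lemma card_vec_le:
  fixes S :: "'d::finite \<Rightarrow> 'a set"
  assumes "\<And>i. finite (S i)" "\<And>i. card (S i) \<le> m"
  shows "finite {v::'a^'d. \<forall>i. v$i \<in> S i}" "card {v::'a^'d. \<forall>i. v$i \<in> S i} \<le> m ^ CARD('d)"
proof -
  have eq: "{v::'a^'d. \<forall>i. v$i \<in> S i} = vec_lambda ` (PiE UNIV S)"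
  proof (intro equalityI subsetI)
    fix v :: "'a^'d" assume "v \<in> {v. \<forall>i. v$i \<in> S i}"
    then have "vec_nth v \<in> PiE UNIV S" by auto
    then show "v \<in> vec_lambda ` (PiE UNIV S)"
      by (intro image_eqI[of _ _ "vec_nth v"]) auto
  qed auto
  have fin: "finite (PiE UNIV S)" using assms(1) by (intro finite_PiE) auto
  then show "finite {v::'a^'d. \<forall>i. v$i \<in> S i}" unfolding eq by simp
  have "card {v::'a^'d. \<forall>i. v$i \<in> S i} \<le> card (PiE UNIV S)"
    unfolding eq by (rule card_image_le[OF fin])
  also have "\<dots> = (\<Prod>i\<in>UNIV. card (S i))" by (simp add: card_PiE)
  also have "\<dots> \<le> (\<Prod>i\<in>(UNIV::'d set). m)" by (intro prod_mono) (simp add: assms(2))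
  finally show "card {v::'a^'d. \<forall>i. v$i \<in> S i} \<le> m ^ CARD('d)" by simp
qed

lemma card_nat_interval_le:
  assumes "0 \<le> w"
  shows "finite {n::nat. a \<le> real n \<and> real n \<le> a + w}"
    "real (card {n::nat. a \<le> real n \<and> real n \<le> a + w}) \<le> w + 1"
proof -
  let ?S = "{n::nat. a \<le> real n \<and> real n \<le> a + w}"
  have inj: "inj_on int ?S" by simp
  have im: "int ` ?S \<subseteq> {\<lceil>a\<rceil>..\<lfloor>a + w\<rfloor>}"
    by (auto simp: ceiling_le_iff le_floor_iff)
  show "finite ?S" using inj_on_finite[OF inj im] by simp
  have "card ?S \<le> card {\<lceil>a\<rceil>..\<lfloor>a + w\<rfloor>}" by (rule card_inj_on_le[OF inj im]) simp
  then have "real (card ?S) \<le> real (nat (\<lfloor>a + w\<rfloor> + 1 - \<lceil>a\<rceil>))" by simp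
  also have "\<dots> = max 0 (real_of_int (\<lfloor>a + w\<rfloor> + 1 - \<lceil>a\<rceil>))" by simp
  also have "\<dots> \<le> w + 1" using assms by (intro max.boundedI; linarith)
  finally show "real (card ?S) \<le> w + 1" .
qed

lemma power_add_one_le:
  fixes t :: real
  assumes "0 \<le> t"
  shows "(2 * t + 2) ^ n \<le> 4 ^ n * (1 + t ^ n)"
proof -
  have "(2 * t + 2) ^ n \<le> (4 * max 1 t) ^ n" using assms by (intro power_mono) auto
  also have "\<dots> = 4 ^ n * (max 1 t) ^ n" by (simp add: power_mult_distrib)
  also have "(max 1 t) ^ n \<le> 1 + t ^ n" using assms by (auto simp: max_def)
  finally show ?thesis by simp
qed

text \<open>In each coordinate the index lies in an interval of length
  \<open>2 * (\<rho> * 2^j) + 1\<close>. The product of these counts is split into a constant, which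
  dominates for small balls, and a volume term.\<close>

lemma card_ccubes_meeting_ball:
  fixes c :: "real^'d"
  assumes "0 \<le> \<rho>"
  shows "finite {v. ccube j v \<inter> ball_inf c \<rho> \<noteq> {}}"
    "real (card {v. ccube j v \<inter> ball_inf c \<rho> \<noteq> {}}) \<le> 4 ^ CARD('d) * (1 + (\<rho> * 2^j) ^ CARD('d))"
proof -
  let ?A = "{v. ccube j v \<inter> ball_inf c \<rho> \<noteq> {}}"
  define S where "S i = {n::nat. (c$i - \<rho>) * 2^j - 1 \<le> real n \<and> real n \<le> ((c$i - \<rho>) * 2^j - 1) + (2 * (\<rho> * 2^j) + 1)}" for i
  define m where "m = nat \<lfloor>2 * (\<rho> * 2^j) + 2\<rfloor>"
  have w: "0 \<le> 2 * (\<rho> * 2^j) + 1" using assms by simp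
  have fin: "finite (S i)" for i unfolding S_def by (rule card_nat_interval_le(1)[OF w])
  have "real (card (S i)) \<le> 2 * (\<rho> * 2^j) + 2" for i
    using card_nat_interval_le(2)[OF w, of "(c$i - \<rho>) * 2^j - 1"] unfolding S_def by simp
  then have cm: "card (S i) \<le> m" for i unfolding m_def by (intro le_nat_floor)
  have sub: "?A \<subseteq> {v. \<forall>i. v$i \<in> S i}"
  proof (intro subsetI CollectI allI)
    fix v i assume "v \<in> ?A"
    then obtain y where y: "y \<in> ccube j v" "linf_dist c y \<le> \<rho>" by (auto simp: ball_inf_def)
    have b: "\<bar>c$i - y$i\<bar> \<le> \<rho>" using y(2) linf_dist_le_iff by blast
    have "real (v$i) \<le> y$i * 2^j" "y$i * 2^j \<le> real (v$i) + 1"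
      using y(1) unfolding ccube_def by (auto simp: field_simps)
    moreover have "(c$i - \<rho>) * 2^j \<le> y$i * 2^j" "y$i * 2^j \<le> (c$i + \<rho>) * 2^j"
      using b by (intro mult_right_mono; simp)+
    ultimately show "v$i \<in> S i" unfolding S_def by (simp add: algebra_simps)
  qed
  show "finite ?A" using finite_subset[OF sub card_vec_le(1)[of S m, OF fin cm]] .
  have "card ?A \<le> m ^ CARD('d)"
    using card_mono[OF card_vec_le(1)[of S m, OF fin cm] sub] card_vec_le(2)[of S m, OF fin cm] by linarith
  then have "real (card ?A) \<le> real m ^ CARD('d)" by (metis of_nat_le_iff of_nat_power)
  also have "\<dots> \<le> (2 * (\<rho> * 2^j) + 2) ^ CARD('d)"
    unfolding m_def by (intro power_mono of_nat_floor) (use w in simp_all)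
  also have "\<dots> \<le> 4 ^ CARD('d) * (1 + (\<rho> * 2^j) ^ CARD('d))"
    using assms by (intro power_add_one_le) simp
  finally show "real (card ?A) \<le> 4 ^ CARD('d) * (1 + (\<rho> * 2^j) ^ CARD('d))" .
qed

text \<open>At a coordinate equal to 1 the index is \<open>2^j\<close>, so on
  \<open>closed_cube01\<close> it need not be \<open>valid_dyadic\<close>; the counts of cells
  accordingly run over all index vectors.\<close>

definition dyadic_index :: "nat \<Rightarrow> real^'d \<Rightarrow> nat^'d" where
  "dyadic_index j y = (\<chi> i. nat \<lfloor>2^j * y$i\<rfloor>)"

lemma dyadic_index_bounds:
  assumes "y \<in> closed_cube01"
  shows "real (dyadic_index j y $ i) \<le> 2^j * y$i" "2^j * y$i < real (dyadic_index j y $ i) + 1"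
proof -
  have "0 \<le> 2^j * y$i" using assms by (simp add: closed_cube01_def)
  then show "real (dyadic_index j y $ i) \<le> 2^j * y$i" "2^j * y$i < real (dyadic_index j y $ i) + 1"
    by (simp_all add: dyadic_index_def of_nat_nat)
qed

lemma mem_ccube_dyadic_index:
  assumes "y \<in> closed_cube01"
  shows "y \<in> ccube j (dyadic_index j y)"
  unfolding ccube_def
  using dyadic_index_bounds[OF assms, of j] by (auto simp: field_simps intro: less_imp_le)

lemma linf_dist_ccube: "y \<in> ccube j v \<Longrightarrow> z \<in> ccube j v \<Longrightarrow> linf_dist y z \<le> 1 / 2^j"
  unfolding linf_dist_le_iff ccube_def by (auto simp: add_divide_distrib abs_le_iff) (smt (verit))+

lemma powr_real_eq_power: "2 powr (- real k) = 1 / (2::real)^k"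
  by (simp add: powr_minus powr_realpow divide_inverse)

lemma T_set_radius:
  assumes "p \<in> T_set x r k"
  shows "1 / 2^(k+1) < r p" "r p \<le> 1 / 2^k"
proof -
  have "2 powr (-(real k + 1)) = 1 / (2::real)^(k+1)"
    using powr_real_eq_power[of "k+1"] by (simp add: add.commute)
  then show "1 / 2^(k+1) < r p" "r p \<le> 1 / 2^k"
    using assms unfolding T_set_def by (auto simp: powr_real_eq_power)
qed

text \<open>Two points in one cell of side \<open>2\<^bsup>-(k+1)\<^esup>\<close> have intersecting balls, so each disjoint class
  of \<open>C1_seq\<close> injects into the cells.\<close>
lemma card_T_set_near:
  fixes x :: "nat \<Rightarrow> real^'d"
  assumes sys: "is_system x r" and C1: "C1_seq x r N" and k: "1 \<le> k" "g \<le> k"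
  shows "finite {p \<in> T_set x r k. x p \<in> ball_inf c (2 / 2^g)}" (is "finite ?A")
    "real (card {p \<in> T_set x r k. x p \<in> ball_inf c (2 / 2^g)})
       \<le> real (N k) * (2 * 16 ^ CARD('d)) * 2 ^ (CARD('d) * (k - g))"
proof -
  let ?B = "{v. ccube (k+1) v \<inter> ball_inf c (2 / 2^g) \<noteq> {}}"
  have "\<exists>P. T_set x r k = (\<Union>i<N k. P i) \<and>
      (\<forall>i<N k. \<forall>i'<N k. i \<noteq> i' \<longrightarrow> P i \<inter> P i' = {}) \<and>
      (\<forall>i<N k. \<forall>n\<in>P i. \<forall>m\<in>P i. n \<noteq> m \<longrightarrow> ball_inf (x n) (r n) \<inter> ball_inf (x m) (r m) = {})"
    using C1 k(1) unfolding C1_seq_def by simp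
  then obtain P where P: "T_set x r k = (\<Union>i<N k. P i)"
    and dj: "\<forall>i<N k. \<forall>n\<in>P i. \<forall>m\<in>P i. n \<noteq> m \<longrightarrow> ball_inf (x n) (r n) \<inter> ball_inf (x m) (r m) = {}"
    by (elim exE conjE) rule
  have disj: "ball_inf (x n) (r n) \<inter> ball_inf (x m) (r m) = {}"
    if "i < N k" "n \<in> P i" "m \<in> P i" "n \<noteq> m" for i n m
    using dj that by simp
  have cub: "x n \<in> closed_cube01" for n using sys unfolding is_system_def by blast
  have finB: "finite ?B" by (rule card_ccubes_meeting_ball) simp
  define Q where "Q i = {p \<in> P i. x p \<in> ball_inf c (2 / 2^g)}" for i
  have inj: "inj_on (\<lambda>p. dyadic_index (k+1) (x p)) (Q i)" if i: "i < N k" for i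
  proof (rule inj_onI, rule ccontr)
    fix p q assume p: "p \<in> Q i" and q: "q \<in> Q i"
      and eq: "dyadic_index (k+1) (x p) = dyadic_index (k+1) (x q)" and ne: "p \<noteq> q"
    have "linf_dist (x p) (x q) \<le> 1 / 2^(k+1)"
      using linf_dist_ccube mem_ccube_dyadic_index[OF cub] eq by metis
    also have "\<dots> < r p" using T_set_radius(1)[of p x r k] p P i by (auto simp: Q_def)
    finally have "x q \<in> ball_inf (x p) (r p)" by (simp add: ball_inf_def)
    moreover have "x q \<in> ball_inf (x q) (r q)"
      using sys linf_dist_eq_0_iff[of "x q" "x q"] by (simp add: ball_inf_def is_system_def less_imp_le)
    ultimately show False using disj[OF i, of p q] p q ne by (auto simp: Q_def)
  qed
  have im: "(\<lambda>p. dyadic_index (k+1) (x p)) ` Q i \<subseteq> ?B" for i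
    using mem_ccube_dyadic_index[OF cub] by (auto simp: Q_def)
  have fQ: "finite (Q i)" if "i < N k" for i by (rule inj_on_finite[OF inj[OF that] im finB])
  have cQ: "card (Q i) \<le> card ?B" if "i < N k" for i by (rule card_inj_on_le[OF inj[OF that] im finB])
  have A: "?A = (\<Union>i\<in>{..<N k}. Q i)" unfolding P Q_def by auto
  show "finite ?A" unfolding A using fQ by auto
  have "card ?A \<le> (\<Sum>i<N k. card (Q i))" unfolding A by (rule card_UN_le) simp
  also have "\<dots> \<le> (\<Sum>i<N k. card ?B)" by (intro sum_mono cQ) simp
  finally have c1: "card ?A \<le> N k * card ?B" by simp
  \<comment> \<open>The ball has radius \<open>2 / 2^g\<close> and the cells have side
    \<open>1 / 2^(k+1)\<close>. This ratio contributes one factor \<open>4 ^ CARD('d)\<close>, the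
    count of cells contributes the other, and together they give
    \<open>16 ^ CARD('d)\<close>.\<close>
  have e: "2 / 2^g * 2^(k+1) = 4 * (2::real)^(k-g)"
    unfolding power_diff[OF zero_neq_numeral[symmetric] k(2)] by simp
  have "real (card ?B) \<le> 4 ^ CARD('d) * (1 + (4 * 2^(k-g)) ^ CARD('d))"
    using card_ccubes_meeting_ball(2)[of "2 / 2^g" "k+1" c] unfolding e by simp
  also have "\<dots> \<le> 4 ^ CARD('d) * (2 * (4 * 2^(k-g)) ^ CARD('d))"
  proof -
    have "1 \<le> 4 * (2::real)^(k-g)" using one_le_power[of "2::real" "k-g"] by linarith
    then have "1 \<le> (4 * (2::real)^(k-g)) ^ CARD('d)" by (rule one_le_power)
    then show ?thesis by simp
  qed
  also have "\<dots> = (2 * 16 ^ CARD('d)) * 2 ^ (CARD('d) * (k - g))"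
  proof -
    have "(4 * (2::real)^(k-g)) ^ CARD('d) = 4 ^ CARD('d) * 2 ^ (CARD('d) * (k - g))"
      unfolding power_mult_distrib mult.commute[of "CARD('d)"] by (subst power_mult) (rule refl)
    moreover have "(16::real) ^ CARD('d) = 4 ^ CARD('d) * 4 ^ CARD('d)"
      by (simp flip: power_mult_distrib)
    ultimately show ?thesis by simp
  qed
  finally have "real (card ?B) \<le> (2 * 16 ^ CARD('d)) * 2 ^ (CARD('d) * (k - g))" .
  then have "real (N k) * real (card ?B) \<le> real (N k) * ((2 * 16 ^ CARD('d)) * 2 ^ (CARD('d) * (k - g)))"
    by (intro mult_left_mono) auto
  moreover have "real (card ?A) \<le> real (N k) * real (card ?B)" 
    unfolding of_nat_mult[symmetric] of_nat_le_iff by (rule c1)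
  ultimately show "real (card ?A) \<le> real (N k) * (2 * 16 ^ CARD('d)) * 2 ^ (CARD('d) * (k - g))"
    by (simp add: mult.assoc)
qed

text \<open>The unit cube lies in the ball of radius 2 about the origin, so this is the local count
  with \<open>g = 0\<close>.\<close>

lemma card_T_set:
  fixes x :: "nat \<Rightarrow> real^'d"
  assumes sys: "is_system x r" and C1: "C1_seq x r N" and k: "1 \<le> k"
  shows "finite (T_set x r k)"
    "real (card (T_set x r k)) \<le> real (N k) * (2 * 16 ^ CARD('d)) * 2 ^ (CARD('d) * k)"
proof -
  have "x p \<in> ball_inf 0 (2 / 2^0)" for p
    using sys by (auto simp: ball_inf_def linf_dist_le_iff is_system_def closed_cube01_def intro: order_trans[of _ 1])
  then have eq: "{p \<in> T_set x r k. x p \<in> ball_inf 0 (2 / 2^0)} = T_set x r k" by auto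
  show "finite (T_set x r k)"
    "real (card (T_set x r k)) \<le> real (N k) * (2 * 16 ^ CARD('d)) * 2 ^ (CARD('d) * k)"
    using card_T_set_near[OF sys C1 k, of 0 0] unfolding eq by simp_all
qed

section \<open>Growth of the multiplicities and coverings of the limsup sets\<close>

lemma C1_seq_growth:
  assumes C1: "C1_seq x r N" and e: "0 < \<epsilon>"
  shows "\<forall>\<^sub>F k in sequentially. real (N k) \<le> 2 powr (\<epsilon> * real k)"
proof -
  have "(\<lambda>j. log 2 (real (N j)) / real j) \<longlonglongrightarrow> 0" and pos: "\<And>j. 0 < N j"
    using C1 unfolding C1_seq_def by auto
  then have "\<forall>\<^sub>F j in sequentially. log 2 (real (N j)) / real j < \<epsilon>"
    using e by (auto dest: order_tendstoD(2))
  then show ?thesis using eventually_gt_at_top[of 0]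
  proof eventually_elim
    case (elim j)
    then have "log 2 (real (N j)) \<le> \<epsilon> * real j" by (simp add: field_simps)
    then have "2 powr log 2 (real (N j)) \<le> 2 powr (\<epsilon> * real j)" by (intro powr_mono) auto
    then show ?case using pos[of j] by simp
  qed
qed

text \<open>Half of the exponential decay absorbs the subexponential growth of \<open>N\<close>; the
  other half leaves a geometric series.\<close>

lemma C1_seq_summable:
  assumes C1: "C1_seq x r N" and c: "0 < c"
  shows "summable (\<lambda>k. real (N k) * 2 powr (- c * real k))"
proof (rule summable_comparison_test_ev)
  have "c / 2 > 0" using c by simp
  from C1_seq_growth[OF C1 this]
  show "\<forall>\<^sub>F k in sequentially. norm (real (N k) * 2 powr (- c * real k)) \<le> (2 powr (- (c/2))) ^ k"
  proof eventually_elim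
    case (elim k)
    have "real (N k) * 2 powr (- c * real k) \<le> 2 powr (c / 2 * real k) * 2 powr (- c * real k)"
      using elim by (intro mult_right_mono) auto
    also have "\<dots> = 2 powr (- (c/2) * real k)" by (simp flip: powr_add add: algebra_simps)
    also have "\<dots> = (2 powr (- (c/2))) ^ k"
      by (simp add: powr_powr flip: powr_realpow)
    finally show ?case by simp
  qed
  show "summable (\<lambda>k. (2 powr (- (c/2))) ^ k)"
    using c by (intro summable_geometric) (simp add: powr_less_one)
qed

text \<open>Passing to the first occurrence of a point keeps the centre and does not decrease the
  radius. If only finitely many first occurrences arose, one centre would serve infinitely many
  indices; their radii tend to 0, so \<open>y\<close> would have to be that centre.\<close>

lemma infinite_first_occ:
  fixes x :: "nat \<Rightarrow> real^'d"
  assumes sys: "is_system x r" and y: "y \<notin> range x" and \<delta>: "0 < \<delta>"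
    and inf: "infinite {n. linf_dist y (x n) \<le> r n powr \<delta>}"
  shows "infinite {p. first_occ x p \<and> linf_dist y (x p) \<le> r p powr \<delta>}"
proof
  let ?S = "{n. linf_dist y (x n) \<le> r n powr \<delta>}"
  let ?S' = "{p. first_occ x p \<and> linf_dist y (x p) \<le> r p powr \<delta>}"
  assume fin: "finite ?S'"
  have rpos: "\<And>n. 0 < r n" and dec: "decseq r" and lim: "r \<longlonglongrightarrow> 0"
    using sys unfolding is_system_def by auto
  define fo where "fo n = (LEAST p. x p = x n)" for n
  have fo: "x (fo n) = x n" "fo n \<le> n" "first_occ x (fo n)" for n
  proof -
    show 1: "x (fo n) = x n" unfolding fo_def by (rule LeastI[of _ n]) simp
    show "fo n \<le> n" unfolding fo_def by (rule Least_le) simp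
    show "first_occ x (fo n)" unfolding first_occ_def 1 unfolding fo_def using not_less_Least by blast
  qed
  have "fo ` ?S \<subseteq> ?S'"
  proof
    fix p assume "p \<in> fo ` ?S"
    then obtain n where n: "p = fo n" "linf_dist y (x n) \<le> r n powr \<delta>" by auto
    have "r n \<le> r (fo n)" using dec fo(2) by (simp add: decseq_def)
    then have "r n powr \<delta> \<le> r (fo n) powr \<delta>" using \<delta> rpos[of n] by (intro powr_mono2) auto
    then show "p \<in> ?S'" using n fo by simp
  qed
  then have "finite (fo ` ?S)" using fin finite_subset by blast
  from pigeonhole_infinite[OF inf this]
  obtain m where m: "infinite {a \<in> ?S. fo a = fo m}" by blast
  define e where "e = linf_dist y (x m)"
  have "e > 0" using y linf_dist_eq_0_iff[of y "x m"] linf_dist_nonneg[of y "x m"] unfolding e_def by force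
  then have "0 < e powr (1/\<delta>)" by simp
  then have "\<forall>\<^sub>F n in sequentially. r n < e powr (1/\<delta>)" using order_tendstoD(2)[OF lim] by blast
  then obtain n0 where n0: "\<And>n. n \<ge> n0 \<Longrightarrow> r n < e powr (1/\<delta>)" unfolding eventually_sequentially by blast
  obtain n where n: "n \<ge> n0" "linf_dist y (x n) \<le> r n powr \<delta>" "fo n = fo m"
    using m unfolding infinite_nat_iff_unbounded_le by blast
  have "x n = x m" using fo(1) n(3) by metis
  then have "e \<le> r n powr \<delta>" using n(2) e_def by simp
  also have "\<dots> < (e powr (1/\<delta>)) powr \<delta>" using n0[OF n(1)] rpos[of n] \<delta> by (intro powr_less_mono2) auto
  also have "\<dots> = e" using powr_inverse_exponent \<delta> \<open>e > 0\<close> by blast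
  finally show False by simp
qed

lemma generation_of_radius:
  assumes "0 < \<rho>" "\<rho> \<le> 1"
  obtains k :: nat where "real k \<le> - log 2 \<rho>" "- log 2 \<rho> < real k + 1"
    "2 powr (-(real k + 1)) < \<rho>" "\<rho> \<le> 2 powr (- real k)"
proof -
  define k where "k = nat \<lfloor>- log 2 \<rho>\<rfloor>"
  have "0 \<le> - log 2 \<rho>" using assms by simp
  then have b: "real k \<le> - log 2 \<rho>" "- log 2 \<rho> < real k + 1" unfolding k_def by (auto simp: of_nat_nat)
  have r: "\<rho> = 2 powr (log 2 \<rho>)" using assms by simp
  have "2 powr (-(real k + 1)) < \<rho>" by (subst r, intro powr_less_mono) (use b in auto)
  moreover have "\<rho> \<le> 2 powr (- real k)" by (subst r, intro powr_mono) (use b in auto)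
  ultimately show ?thesis using that b by blast
qed

text \<open>Balls of generation \<open>k\<close> contribute at most a constant times
  \<open>N k\<close> times 2 to the power \<open>(d - \<delta> t) k\<close>, with \<open>d\<close>
  the dimension. This is summable as \<open>\<delta> * t\<close> exceeds \<open>d\<close>, so the
  tails of the family of balls are arbitrarily economical covers.\<close>

lemma null_covers_L_set:
  fixes x :: "nat \<Rightarrow> real^'d"
  assumes sys: "is_system x r" and C1: "C1_seq x r N" and \<delta>: "0 < \<delta>" and t: "0 < t"
    and dt: "real CARD('d) < \<delta> * t"
  shows "null_covers t (L_set x r \<delta>)"
proof -
  have rpos: "\<And>n. 0 < r n" and lim: "r \<longlonglongrightarrow> 0" using sys unfolding is_system_def by auto
  \<comment> \<open>A bound for the diameter of the ball, set to 0 at repeated centres and at radii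
    above 1/2. The cut at 1/2 keeps the generations at least 1, where the bound on
    \<open>T_set\<close> is available.\<close>
  define h where "h p = (if first_occ x p \<and> r p \<le> 1/2 then 2 * r p powr \<delta> else 0)" for p
  define C where "C = 2 powr t * (2 * 16 ^ CARD('d))"
  define c where "c = \<delta> * t - real CARD('d)"
  have hT: "h p powr t \<le> 2 powr t * 2 powr (- \<delta> * t * real k)" if "p \<in> T_set x r k" for p k
  proof (cases "first_occ x p \<and> r p \<le> 1/2")
    case True
    have "h p powr t = 2 powr t * r p powr (\<delta> * t)"
      using True rpos[of p] by (simp add: h_def powr_mult powr_powr)
    also have "r p powr (\<delta> * t) \<le> (2 powr (- real k)) powr (\<delta> * t)"
      using that \<delta> t rpos[of p] by (intro powr_mono2) (auto simp: T_set_def)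
    also have "\<dots> = 2 powr (- \<delta> * t * real k)" by (simp add: powr_powr mult_ac)
    finally show ?thesis by simp
  qed (use t in \<open>auto simp: h_def\<close>)
  have Tsum: "(\<Sum>p\<in>T_set x r k. h p powr t) \<le> C * (real (N k) * 2 powr (- c * real k))" if k: "1 \<le> k" for k
  proof -
    have "(\<Sum>p\<in>T_set x r k. h p powr t) \<le> real (card (T_set x r k)) * (2 powr t * 2 powr (- \<delta> * t * real k))"
      by (rule sum_bounded_above) (rule hT)
    also have "\<dots> \<le> real (N k) * (2 * 16 ^ CARD('d)) * 2 ^ (CARD('d) * k) * (2 powr t * 2 powr (- \<delta> * t * real k))"
      by (intro mult_right_mono card_T_set[OF sys C1 k]) auto
    also have "\<dots> = C * (real (N k) * (2 powr (real (CARD('d) * k)) * 2 powr (- \<delta> * t * real k)))"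
      unfolding C_def by (subst powr_realpow) auto
    also have "2 powr (real (CARD('d) * k)) * 2 powr (- \<delta> * t * real k) = 2 powr (- c * real k)"
      by (simp flip: powr_add add: c_def algebra_simps)
    finally show ?thesis .
  qed
  have smN: "summable (\<lambda>k. C * (real (N k) * 2 powr (- c * real k)))"
    using dt by (intro summable_mult C1_seq_summable[OF C1]) (simp add: c_def)
  have sm: "summable (\<lambda>p. h p powr t)"
  proof (rule bounded_imp_summable)
    fix n :: nat
    define S where "S = {p. p \<le> n \<and> first_occ x p \<and> r p \<le> 1/2}"
    have "\<exists>k. p \<in> S \<longrightarrow> p \<in> T_set x r k \<and> 1 \<le> k" for p
    proof (cases "p \<in> S")
      case True
      then have "r p \<le> 1" unfolding S_def by auto
      from generation_of_radius[OF rpos this] obtain k where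
        k: "- log 2 (r p) < real k + 1" "2 powr (-(real k + 1)) < r p" "r p \<le> 2 powr (- real k)" by blast
      have "log 2 (r p) \<le> log 2 (1/2)" using rpos[of p] True unfolding S_def by (subst log_le_cancel_iff) auto
      then have "1 \<le> k" using k(1) by (simp add: log_divide)
      then show ?thesis using k True unfolding T_set_def S_def by blast
    qed simp
    \<comment> \<open>Each relevant index receives a generation; the partial sum is regrouped by
      generation and compared with the summable majorant.\<close>
    then obtain \<kappa> where \<kappa>: "\<And>p. p \<in> S \<Longrightarrow> p \<in> T_set x r (\<kappa> p) \<and> 1 \<le> \<kappa> p" by metis
    have finS: "finite S" unfolding S_def by simp
    define K where "K = Max (insert 1 (\<kappa> ` S))"
    have sub: "\<kappa> ` S \<subseteq> {1..K}" unfolding K_def using \<kappa> finS by auto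
    have "(\<Sum>p\<le>n. h p powr t) = (\<Sum>p\<in>S. h p powr t)"
      by (rule sum.mono_neutral_right) (auto simp: S_def h_def)
    also have "\<dots> = (\<Sum>k\<in>{1..K}. \<Sum>p\<in>{p \<in> S. \<kappa> p = k}. h p powr t)"
      by (rule sum.group[symmetric, OF finS finite_atLeastAtMost sub])
    also have "\<dots> \<le> (\<Sum>k\<in>{1..K}. \<Sum>p\<in>T_set x r k. h p powr t)"
      using \<kappa> by (intro sum_mono sum_mono2 card_T_set(1)[OF sys C1]) auto
    also have "\<dots> \<le> (\<Sum>k\<in>{1..K}. C * (real (N k) * 2 powr (- c * real k)))"
      by (intro sum_mono Tsum) simp
    also have "\<dots> \<le> (\<Sum>k. C * (real (N k) * 2 powr (- c * real k)))"
      by (intro sum_le_suminf smN) (auto simp: C_def)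
    finally show "(\<Sum>p\<le>n. h p powr t) \<le> (\<Sum>k. C * (real (N k) * 2 powr (- c * real k)))" .
  qed simp
  have "null_covers t (L_set x r \<delta> - range x)"
  proof (rule null_coversI[OF t])
    fix \<epsilon> :: real assume e: "\<epsilon> > 0"
    obtain n1 where n1: "\<And>n. n \<ge> n1 \<Longrightarrow> norm (\<Sum>i. h (i + n) powr t) < \<epsilon>"
      using suminf_exist_split[OF e sm] by blast
    have "\<forall>\<^sub>F n in sequentially. r n < 1/2" using order_tendstoD(2)[OF lim, of "1/2"] by simp
    then obtain n2 where n2: "\<And>n. n \<ge> n2 \<Longrightarrow> r n < 1/2" unfolding eventually_sequentially by blast
    \<comment> \<open>Beyond \<open>P\<close> the tail is small and all radii are below 1/2, so
      \<open>h\<close> really bounds the diameters.\<close>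
    define P where "P = max n1 n2"
    define U where "U i = (if first_occ x (i + P) then ball_inf (x (i + P)) (r (i + P) powr \<delta>) else {})" for i
    have cov: "L_set x r \<delta> - range x \<subseteq> \<Union>(range U)"
    proof
      fix y assume "y \<in> L_set x r \<delta> - range x"
      then have "infinite {p. first_occ x p \<and> linf_dist y (x p) \<le> r p powr \<delta>}"
        by (intro infinite_first_occ[OF sys _ \<delta>]) (auto simp: L_set_def)
      then obtain p where p: "p \<ge> P" "first_occ x p" "linf_dist y (x p) \<le> r p powr \<delta>"
        unfolding infinite_nat_iff_unbounded_le by blast
      then have "y \<in> U (p - P)" by (simp add: U_def ball_inf_def linf_dist_commute)
      then show "y \<in> \<Union>(range U)" by blast
    qed
    have diam: "linf_dist y z \<le> h (i + P)" if "y \<in> U i" "z \<in> U i" for i y z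
    proof -
      have i: "first_occ x (i + P)" "linf_dist (x (i + P)) y \<le> r (i + P) powr \<delta>"
        "linf_dist (x (i + P)) z \<le> r (i + P) powr \<delta>"
        using that by (auto simp: U_def ball_inf_def split: if_splits)
      have "r (i + P) \<le> 1/2" using n2[of "i + P"] unfolding P_def by linarith
      then show ?thesis
        using i linf_dist_triangle[of y z "x (i + P)"] linf_dist_commute[of y "x (i + P)"] by (simp add: h_def)
    qed
    have "(\<Sum>i. h (i + P) powr t) < \<epsilon>" using n1[of P] by (simp add: P_def)
    moreover have "summable (\<lambda>i. h (i + P) powr t)" using sm by (simp add: summable_iff_shift[of "\<lambda>i. h i powr t"])
    moreover have "0 \<le> h (i + P)" for i by (simp add: h_def)
    ultimately show "\<exists>U b. L_set x r \<delta> - range x \<subseteq> \<Union>(range U) \<and>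
     (\<forall>i::nat. 0 \<le> b i \<and> (\<forall>y\<in>U i. \<forall>z\<in>U i. linf_dist y z \<le> b i)) \<and>
     summable (\<lambda>i. b i powr t) \<and> (\<Sum>i. b i powr t) < \<epsilon>"
      using cov diam by (intro exI[of _ U] exI[of _ "\<lambda>i. h (i + P)"]) blast
  qed
  from null_covers_Un[OF this null_covers_range[OF t, of x]]
  show ?thesis by (rule null_covers_subset) blast
qed

lemma open_cube01_subset_closed: "open_cube01 \<subseteq> closed_cube01"
  by (auto simp: open_cube01_def closed_cube01_def less_imp_le)

text \<open>The supremum provides an exponent above \<open>\<delta>\<close>, and once the radii are
  below 1 the balls with the larger exponent lie inside those with the smaller one.\<close>

lemma approx_rate_lessD:
  fixes x :: "nat \<Rightarrow> real^'d"
  assumes sys: "is_system x r" and \<delta>: "0 < \<delta>" and lt: "ereal \<delta> < approx_rate x r y"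
  shows "y \<in> L_set x r \<delta>"
proof -
  have rpos: "\<And>n. 0 < r n" and lim: "r \<longlonglongrightarrow> 0" using sys unfolding is_system_def by auto
  obtain \<delta>' where d': "\<delta> < \<delta>'" "y \<in> L_set x r \<delta>'"
    using lt \<delta> unfolding approx_rate_def less_Sup_iff by auto
  have "\<forall>\<^sub>F n in sequentially. r n < 1" using order_tendstoD(2)[OF lim, of 1] by simp
  then obtain n1 where n1: "\<And>n. n \<ge> n1 \<Longrightarrow> r n < 1" unfolding eventually_sequentially by blast
  let ?S = "{n. linf_dist y (x n) \<le> r n powr \<delta>'}"
  have "?S - {..<n1} \<subseteq> {n. linf_dist y (x n) \<le> r n powr \<delta>}"
  proof
    fix n assume n: "n \<in> ?S - {..<n1}"
    have "r n powr \<delta>' \<le> r n powr \<delta>"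
      using n1[of n] n rpos[of n] d'(1) by (intro powr_mono') auto
    then show "n \<in> {n. linf_dist y (x n) \<le> r n powr \<delta>}" using n by auto
  qed
  moreover have "infinite (?S - {..<n1})" using d'(2) by (simp add: L_set_def)
  ultimately show ?thesis using d'(2) infinite_super unfolding L_set_def by blast
qed

text \<open>Any exponent strictly between \<open>CARD('d) / t\<close> and \<open>h\<close> works: it
  is below the rate of every point in question, and its product with \<open>t\<close> exceeds the
  dimension.\<close>

lemma null_covers_Lf:
  fixes x :: "nat \<Rightarrow> real^'d"
  assumes sys: "is_system x r" and C1: "C1_seq x r N" and h: "0 < h" "real CARD('d) / h < t"
    and f: "\<And>y. y \<in> A \<Longrightarrow> h \<le> f y"
  shows "null_covers t (Lf x r A f)"
proof -
  have "0 < real CARD('d) / h" using h by simp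
  then have t: "0 < t" using h(2) by linarith
  have "real CARD('d) / t < h" using h t by (simp add: field_simps)
  then obtain \<delta> where d: "real CARD('d) / t < \<delta>" "\<delta> < h" using dense by blast
  moreover have "0 < real CARD('d) / t" using t by simp
  ultimately have "0 < \<delta>" by linarith
  have "real CARD('d) < \<delta> * t" using d t by (simp add: field_simps)
  have "Lf x r A f \<subseteq> L_set x r \<delta>"
  proof
    fix y assume y: "y \<in> Lf x r A f"
    then have "ereal \<delta> < ereal (f y)" using d f[of y] by (auto simp: Lf_def)
    also have "\<dots> \<le> approx_rate x r y" using y by (simp add: Lf_def)
    finally show "y \<in> L_set x r \<delta>" by (rule approx_rate_lessD[OF sys \<open>0 < \<delta>\<close>])
  qed
  then show ?thesis using null_covers_L_set[OF sys C1 \<open>0 < \<delta>\<close> t \<open>real CARD('d) < \<delta> * t\<close>] null_covers_subset by blast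
qed

section \<open>Refining a dyadic cube\<close>

text \<open>The new cube has side comparable to 2 to the power \<open>- \<delta> * (j + 1)\<close>
  and sits next to the point \<open>x m\<close> given by \<open>P_prop\<close>. It lies well inside
  the isolation ball of \<open>x m\<close>, hence far from the other points of the relevant radii,
  and it is shifted slightly off \<open>x m\<close> itself.\<close>

lemma child_cube:
  fixes x :: "nat \<Rightarrow> real^'d"
  assumes sys: "is_system x r" and v: "valid_dyadic j v" and P: "P_prop x r N \<phi> j v \<delta>" and \<delta>: "1 < \<delta>"
  obtains m g' u' where "valid_dyadic g' u'" "ccube g' u' \<subseteq> ccube j v" "j < g'"
    "real g' \<le> real_of_int \<lfloor>\<delta> * (real j + 1)\<rfloor> + 4" "real g' \<le> \<delta> * (real j + 1) + 4"
    "2 powr (-(real j + 1)) \<le> r m" "r m < 2 powr (- real j)"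
    "\<And>y. y \<in> ccube g' u' \<Longrightarrow> linf_dist y (x m) \<le> r m powr \<delta>"
    "\<And>y p. y \<in> ccube g' u' \<Longrightarrow> real (gamma CARD('d) N \<phi> j) \<le> - log 2 (r p) \<Longrightarrow>
        - log 2 (r p) < real_of_int \<lfloor>\<delta> * (real j + 1)\<rfloor> + 4 \<Longrightarrow>
        2 powr (- (\<delta> * (real j + 1) + 4)) \<le> linf_dist y (x p)"
proof -
  obtain m where m: "x m \<in> dcube j v" "2 powr (-(real j + 1)) \<le> r m" "r m < 2 powr (- real j)"
    and iso: "ball_inf (x m) (r m powr \<delta>) \<inter>
        {x p | p. real (gamma CARD('d) N \<phi> j) \<le> - log 2 (r p) \<and>
                  - log 2 (r p) < real_of_int \<lfloor>\<delta> * (real j + 1)\<rfloor> + 4} = {x m}"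
    using P unfolding P_prop_def by blast
  have cub: "x m \<in> closed_cube01" using sys unfolding is_system_def by blast
  define e where "e = \<delta> * (real j + 1)"
  have e: "real j + 1 < e" unfolding e_def using mult_strict_right_mono[OF \<delta>, of "real j + 1"] by simp
  \<comment> \<open>The summand 3 makes three cells together no longer than
    \<open>3/8 * 2 powr (- e)\<close>. Since the ceiling exceeds the floor by at most 1, the
    generation stays within the upper limit of the isolation range in \<open>P_prop\<close>.\<close>
  define g' where "g' = nat \<lceil>e\<rceil> + 3"
  have g'1: "e + 3 \<le> real g'" "real g' \<le> real_of_int \<lfloor>e\<rfloor> + 4" "j + 4 \<le> g'" "real g' \<le> e + 4"
  proof -
    have "real g' = real_of_int \<lceil>e\<rceil> + 3" using e unfolding g'_def by (simp add: of_nat_nat)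
    then show "e + 3 \<le> real g'" "real g' \<le> real_of_int \<lfloor>e\<rfloor> + 4" "real g' \<le> e + 4"
      using ceiling_diff_floor_le_1[of e] by linarith+
    then show "j + 4 \<le> g'" using e by linarith
  qed
  define h where "h = g' - j"
  have h: "g' = j + h" "3 \<le> h" using g'1 unfolding h_def by auto
  have h8: "8 \<le> (2::nat)^h" using power_increasing[OF h(2), of "2::nat"] by simp
  have G: "(2::real)^g' = 2^j * 2^h" unfolding h(1) by (rule power_add)
  define w where "w = dyadic_index g' (x m)"
  have w: "real (w$i) \<le> 2^g' * x m$i" "2^g' * x m$i < real (w$i) + 1" for i
    unfolding w_def by (rule dyadic_index_bounds[OF cub])+
  have xv: "real (v$i * 2^h) \<le> 2^g' * x m$i" "2^g' * x m$i < real ((v$i + 1) * 2^h)" for i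
  proof -
    have "real (v$i) \<le> 2^j * x m$i" "2^j * x m$i < real (v$i) + 1"
      using m(1) unfolding dcube_def by (auto simp: field_simps)
    then have "real (v$i) * 2^h \<le> (2^j * x m$i) * 2^h" "(2^j * x m$i) * 2^h < (real (v$i) + 1) * 2^h"
      by (simp_all only: mult_le_cancel_right_pos mult_less_cancel_right_pos zero_less_power zero_less_numeral)
    then show "real (v$i * 2^h) \<le> 2^g' * x m$i" "2^g' * x m$i < real ((v$i + 1) * 2^h)"
      unfolding G by (simp_all add: algebra_simps)
  qed
  have wv: "v$i * 2^h \<le> w$i" "w$i < (v$i + 1) * 2^h" for i
  proof -
    have "real (v$i * 2^h) < real (w$i + 1)" using xv(1)[of i] w(2)[of i] by linarith
    then show "v$i * 2^h \<le> w$i" by linarith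
    have "real (w$i) < real ((v$i + 1) * 2^h)" using xv(2)[of i] w(1)[of i] by linarith
    then show "w$i < (v$i + 1) * 2^h" by linarith
  qed
  \<comment> \<open>Moving two cells away from \<open>x m\<close> in every coordinate, in the direction that stays inside \<open>dcube j v\<close>,
    keeps the new cube at distance at least one cell from \<open>x m\<close> itself.\<close>
  define u' :: "nat^'d" where "u' = (\<chi> i. if w$i + 2 < (v$i + 1) * 2^h then w$i + 2 else w$i - 2)"
  \<comment> \<open>There are at least eight cells along an edge. If moving up by two would leave
    the cube, then \<open>w$i\<close> is at least 6 above the lower face, so moving down stays
    inside and the subtraction on naturals is not truncated.\<close>
  have cases: "u'$i = w$i + 2 \<or> (u'$i = w$i - 2 \<and> w$i \<ge> v$i * 2^h + 6)" for i
    using h8 wv(2)[of i] by (simp add: u'_def)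
  have uv: "v$i * 2^h \<le> u'$i" "u'$i + 1 \<le> (v$i + 1) * 2^h" for i
    using cases[of i] wv[of i] by (auto simp: u'_def)
  have inc: "ccube g' u' \<subseteq> ccube j v"
  proof
    fix y assume y: "y \<in> ccube g' u'"
    show "y \<in> ccube j v"
      unfolding ccube_def
    proof (intro CollectI allI)
      fix i
      have "real (u'$i) \<le> y$i * 2^g'" "y$i * 2^g' \<le> real (u'$i + 1)"
        using y unfolding ccube_def by (auto simp: field_simps)
      moreover have "real (v$i * 2^h) \<le> real (u'$i)" "real (u'$i + 1) \<le> real ((v$i + 1) * 2^h)"
        using uv[of i] by (simp_all only: of_nat_le_iff)
      ultimately have "real (v$i * 2^h) \<le> y$i * 2^g'" "y$i * 2^g' \<le> real ((v$i + 1) * 2^h)"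
        by linarith+
      then have "real (v$i) * 2^h \<le> (y$i * 2^j) * 2^h" "(y$i * 2^j) * 2^h \<le> (real (v$i) + 1) * 2^h"
        unfolding G by (simp_all add: algebra_simps)
      then have "real (v$i) \<le> y$i * 2^j" "y$i * 2^j \<le> real (v$i) + 1"
        by (simp_all only: mult_le_cancel_right_pos zero_less_power zero_less_numeral)
      then show "real (v$i) / 2^j \<le> y$i \<and> y$i \<le> (real (v$i) + 1) / 2^j" by (simp add: field_simps)
    qed
  qed
  have val: "valid_dyadic g' u'"
    unfolding valid_dyadic_def
  proof
    fix i
    have "v$i + 1 \<le> 2^j" using v unfolding valid_dyadic_def by (simp add: Suc_leI)
    then have "(v$i + 1) * 2^h \<le> 2^j * 2^h" by (rule mult_right_mono) simp
    then show "u'$i < 2^g'" using uv(2)[of i] unfolding h(1) power_add by linarith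
  qed
  have near: "1 / 2^g' \<le> \<bar>y$i - x m$i\<bar>" "\<bar>y$i - x m$i\<bar> \<le> 3 / 2^g'" if y: "y \<in> ccube g' u'" for y i
  proof -
    have yy: "real (u'$i) \<le> y$i * 2^g'" "y$i * 2^g' \<le> real (u'$i) + 1"
      using y unfolding ccube_def by (auto simp: field_simps)
    have "1 \<le> \<bar>y$i * 2^g' - x m$i * 2^g'\<bar> \<and> \<bar>y$i * 2^g' - x m$i * 2^g'\<bar> \<le> 3"
      using cases[of i]
    proof
      assume "u'$i = w$i + 2"
      then have "real (u'$i) = real (w$i) + 2" by simp
      then show ?thesis using yy w[of i] by (simp add: mult.commute) linarith
    next
      assume "u'$i = w$i - 2 \<and> w$i \<ge> v$i * 2^h + 6"
      then have "real (u'$i) = real (w$i) - 2" by simp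
      then show ?thesis using yy w[of i] by (simp add: mult.commute) linarith
    qed
    moreover have "\<bar>y$i * 2^g' - x m$i * 2^g'\<bar> = \<bar>y$i - x m$i\<bar> * 2^g'"
      by (simp add: abs_mult flip: left_diff_distrib)
    ultimately show "1 / 2^g' \<le> \<bar>y$i - x m$i\<bar>" "\<bar>y$i - x m$i\<bar> \<le> 3 / 2^g'" by (auto simp: field_simps)
  qed
  have gp: "1 / (2::real)^g' = 2 powr (- real g')" by (simp add: powr_real_eq_power)
  have small: "3 / 2^g' \<le> 3/8 * 2 powr (- e)"
  proof -
    have "2 powr (- real g') \<le> 2 powr (- e - 3)" using g'1 by (intro powr_mono) auto
    also have "\<dots> = 2 powr (-e) * (1/8)" by (simp add: powr_diff)
    finally show ?thesis using gp by simp
  qed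
  have big: "2 powr (- (e + 4)) \<le> 1 / 2^g'" unfolding gp using g'1 by (intro powr_mono) auto
  have re: "2 powr (- e) \<le> r m powr \<delta>"
  proof -
    have "2 powr (-e) = (2 powr (-(real j + 1))) powr \<delta>" unfolding e_def powr_powr by (simp add: algebra_simps)
    also have "\<dots> \<le> r m powr \<delta>" using m \<delta> by (intro powr_mono2) auto
    finally show ?thesis .
  qed
  have close: "linf_dist y (x m) \<le> 3/8 * 2 powr (-e)" if "y \<in> ccube g' u'" for y
    unfolding linf_dist_le_iff using near(2)[OF that] small by (meson order_trans)
  show ?thesis
  proof (rule that[of g' u' m])
    show "valid_dyadic g' u'" "ccube g' u' \<subseteq> ccube j v" by fact+
    show "j < g'" "real g' \<le> real_of_int \<lfloor>\<delta> * (real j + 1)\<rfloor> + 4" "real g' \<le> \<delta> * (real j + 1) + 4"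
      using g'1 unfolding e_def by auto
    show "2 powr (-(real j + 1)) \<le> r m" "r m < 2 powr (- real j)" by fact+
    fix y assume y: "y \<in> ccube g' u'"
    have "3/8 * 2 powr (-e) \<le> 2 powr (-e)" by simp
    then show "linf_dist y (x m) \<le> r m powr \<delta>" using close[OF y] re by linarith
    fix p assume p: "real (gamma CARD('d) N \<phi> j) \<le> - log 2 (r p)"
      "- log 2 (r p) < real_of_int \<lfloor>\<delta> * (real j + 1)\<rfloor> + 4"
    \<comment> \<open>For the centre \<open>x m\<close> itself the shift by two cells gives the
      bound. Any other \<open>x p\<close> is more than \<open>2 powr (- e)\<close> away from
      \<open>x m\<close>, of which \<open>y\<close> uses up at most three eighths.\<close>
    have "2 powr (- (e + 4)) \<le> linf_dist y (x p)"
    proof (cases "x p = x m")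
      case True
      then show ?thesis
        using near(1)[OF y, of undefined] big component_le_linf_dist[of y undefined "x m"] by simp
    next
      case False
      then have "x p \<notin> ball_inf (x m) (r m powr \<delta>)" using iso p by blast
      then have "r m powr \<delta> < linf_dist (x m) (x p)" by (simp add: ball_inf_def)
      then have 1: "2 powr (-e) < linf_dist (x m) y + linf_dist y (x p)"
        using re linf_dist_triangle[of "x m" "x p" y] by linarith
      have "2 powr (- (e + 4)) = 2 powr (- e - 4)" by simp
      also have "\<dots> = 2 powr (-e) * (1/16)" by (simp add: powr_diff)
      finally have "2 powr (- (e + 4)) = 2 powr (-e) * (1/16)" .
      moreover have "0 < 2 powr (-e)" by simp
      ultimately show ?thesis using 1 close[OF y] linf_dist_commute[of y "x m"] by linarith
    qed
    then show "2 powr (- (\<delta> * (real j + 1) + 4)) \<le> linf_dist y (x p)" by (simp only: e_def)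
  qed
qed

text \<open>Lower faces compare through the lower corner, which belongs to the half-open cube. If an
  upper face stuck out, the half-open cube would contain a point on or beyond the upper face of the
  larger one.\<close>

lemma ccube_subset_of_dcube_subset:
  assumes sub: "dcube j v \<subseteq> dcube g u"
  shows "ccube j v \<subseteq> ccube g u"
proof
  fix y assume y: "y \<in> ccube j v"
  define c :: "real^'a" where "c = (\<chi> i. real (v$i) / 2^j)"
  have c: "c \<in> dcube g u" using sub by (rule subsetD) (simp add: c_def dcube_def field_simps)
  have up: "(real (v$i) + 1) / 2^j \<le> (real (u$i) + 1) / 2^g" for i
  proof (rule ccontr)
    assume "\<not> ?thesis"
    then have lt: "(real (u$i) + 1) / 2^g < (real (v$i) + 1) / 2^j" by simp
    define b where "b = max (real (v$i) / 2^j) ((real (u$i) + 1) / 2^g)"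
    define z :: "real^'a" where "z = (\<chi> l. if l = i then b else c$l)"
    have "real (v$i) / 2^j \<le> b" "b < (real (v$i) + 1) / 2^j"
      using lt unfolding b_def by (auto simp: divide_strict_right_mono)
    then have "z \<in> dcube j v"
      unfolding z_def c_def dcube_def by (auto simp: divide_strict_right_mono)
    then have "z \<in> dcube g u" using sub by blast
    then have "z$i < (real (u$i) + 1) / 2^g" unfolding dcube_def by blast
    then show False by (simp add: z_def b_def)
  qed
  show "y \<in> ccube g u"
    unfolding ccube_def
  proof (intro CollectI allI conjI)
    fix i
    show "real (u$i) / 2^g \<le> y$i"
      using c y unfolding dcube_def ccube_def c_def by (auto intro: order_trans)
    show "y$i \<le> (real (u$i) + 1) / 2^g" using y up[of i] unfolding ccube_def by (blast intro: order_trans)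
  qed
qed

section \<open>The scale \<open>gamma\<close> and the cells near points of intermediate
  radius\<close>

lemma Phi_tendsto_0:
  assumes "In_Phi \<phi>"
  shows "(\<lambda>j. \<phi> (2 powr (- real j))) \<longlonglongrightarrow> 0"
proof -
  have c: "continuous_on {0..} \<phi>" and z: "\<phi> 0 = 0" using assms unfolding In_Phi_def by auto
  have "(\<lambda>j. 2 powr (- real j)) \<longlonglongrightarrow> 0" unfolding powr_real_eq_power by real_asymp
  then have "(\<lambda>j. \<phi> (2 powr (- real j))) \<longlonglongrightarrow> \<phi> 0"
    by (intro continuous_on_tendsto_compose[OF c]) auto
  then show ?thesis using z by simp
qed

text \<open>This is the reciprocal of \<open>t powr (- \<phi> t)\<close> at
  \<open>t = 2 powr (- real j)\<close>. It controls the proportion of cells lost to points of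
  generation below \<open>gamma\<close>, which must become negligible.\<close>

lemma Phi_power_tendsto_0:
  assumes "In_Phi \<phi>"
  shows "(\<lambda>j. 2 powr (- real j * \<phi> (2 powr (- real j)))) \<longlonglongrightarrow> 0"
proof -
  have f: "filterlim (\<lambda>t. t powr (- \<phi> t)) at_top (at_right 0)" using assms unfolding In_Phi_def by auto
  have "filterlim (\<lambda>j. 2 powr (- real j)) (at_right 0) sequentially"
    unfolding powr_real_eq_power by real_asymp
  from filterlim_compose[OF f this]
  have "filterlim (\<lambda>j. 2 powr (real j * \<phi> (2 powr (- real j)))) at_top sequentially"
    by (simp add: powr_powr)
  from tendsto_inverse_0_at_top[OF this] show ?thesis by (simp add: powr_minus)
qed

text \<open>The defining inequality of \<open>gamma\<close> holds slightly below
  \<open>(1 - \<epsilon>) * j\<close> when \<open>j\<close> is large, and it forces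
  \<open>k \<le> j\<close>. So the greatest \<open>k\<close> exists, satisfies the inequality and is
  not much smaller than \<open>j\<close>.\<close>

lemma gamma_properties:
  fixes d :: nat
  assumes Phi: "In_Phi \<phi>" and C1: "C1_seq x r N" and d: "1 \<le> d" and \<epsilon>: "0 < \<epsilon>" "\<epsilon> < 1"
  shows "\<forall>\<^sub>F j in sequentially. (1 - \<epsilon>) * real j - 1 \<le> real (gamma d N \<phi> j) \<and>
    real (N (gamma d N \<phi> j)) * 2 powr (real d * real (gamma d N \<phi> j))
        \<le> 2 powr (- real d * real j * \<phi> (2 powr (- real j))) * 2 powr (real d * real j)"
proof -
  have Npos: "\<And>k. 0 < N k" and mono: "mono N" using C1 unfolding C1_seq_def by auto
  have \<phi>0: "0 \<le> \<phi> (2 powr (- real j))" for j using Phi unfolding In_Phi_def by simp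
  have "\<epsilon> / 2 > 0" using \<epsilon> by simp
  have e1: "\<forall>\<^sub>F j in sequentially. \<phi> (2 powr (- real j)) < \<epsilon> / 2"
    using order_tendstoD(2)[OF Phi_tendsto_0[OF Phi] \<open>\<epsilon> / 2 > 0\<close>] .
  have e2: "\<forall>\<^sub>F j in sequentially. real (N j) \<le> 2 powr (\<epsilon> / 2 * real j)"
    by (rule C1_seq_growth[OF C1 \<open>\<epsilon> / 2 > 0\<close>])
  show ?thesis using e1 e2
  proof eventually_elim
    case (elim j)
    let ?P = "\<lambda>k. real (N k) * 2 powr (real d * real k)
        \<le> 2 powr (- real d * real j * \<phi> (2 powr (- real j))) * 2 powr (real d * real j)"
    \<comment> \<open>Of the exponent saved by \<open>\<epsilon>\<close>, one half pays for
      \<open>N j\<close> and the other half for \<open>\<phi>\<close>.\<close>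
    define k0 where "k0 = nat \<lfloor>(1 - \<epsilon>) * real j\<rfloor>"
    have nn: "0 \<le> (1 - \<epsilon>) * real j" using \<epsilon> by simp
    have k0: "real k0 \<le> (1 - \<epsilon>) * real j" "(1 - \<epsilon>) * real j - 1 \<le> real k0"
      unfolding k0_def using nn by simp_all
    have "(1 - \<epsilon>) * real j \<le> 1 * real j" using \<epsilon> by (intro mult_right_mono) auto
    then have "k0 \<le> j" using k0(1) by simp
    have P0: "?P k0"
    proof -
      have "real (N k0) \<le> real (N j)" using monoD[OF mono \<open>k0 \<le> j\<close>] by simp
      also have "\<dots> \<le> 2 powr (\<epsilon> / 2 * real j)" by (rule elim(2))
      also have "\<dots> \<le> 2 powr (\<epsilon> / 2 * (real d * real j))"
        using d \<epsilon> by (intro powr_mono mult_left_mono) (auto simp: mult_le_cancel_right1)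
      finally have "real (N k0) * 2 powr (real d * real k0)
          \<le> 2 powr (\<epsilon> / 2 * (real d * real j)) * 2 powr (real d * ((1 - \<epsilon>) * real j))"
        using k0(1) by (intro mult_mono powr_mono mult_left_mono) auto
      also have "\<dots> = 2 powr (- (\<epsilon> / 2) * (real d * real j) + real d * real j)"
        by (simp flip: powr_add add: algebra_simps)
      also have "\<dots> \<le> 2 powr (- \<phi> (2 powr (- real j)) * (real d * real j) + real d * real j)"
        using elim(1) by (intro powr_mono add_right_mono mult_right_mono) auto
      finally show ?thesis by (simp flip: powr_add add: algebra_simps)
    qed
    have bound: "k \<le> j" if "?P k" for k
    proof -
      have "2 powr (real d * real k) \<le> real (N k) * 2 powr (real d * real k)"
        using Npos[of k] by (simp add: mult_le_cancel_right1 Suc_leI)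
      also have "\<dots> \<le> 2 powr (- real d * real j * \<phi> (2 powr (- real j))) * 2 powr (real d * real j)" by fact
      also have "\<dots> \<le> 1 * 2 powr (real d * real j)"
        using \<phi>0[of j] powr_mono[of "- real d * real j * \<phi> (2 powr (- real j))" 0 2]
        by (intro mult_right_mono) (auto simp: mult_nonpos_nonneg)
      finally have "real d * real k \<le> real d * real j" by simp
      then show ?thesis using d by simp
    qed
    have g: "gamma d N \<phi> j = (GREATEST k. ?P k)" by (simp add: gamma_def)
    have "?P (gamma d N \<phi> j)" unfolding g by (rule GreatestI_nat[of ?P k0 j]) (use P0 bound in auto)
    moreover have "k0 \<le> gamma d N \<phi> j" unfolding g by (rule Greatest_le_nat[of ?P k0 j]) (use P0 bound in auto)
    ultimately show ?case using k0(2) by auto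
  qed
qed

text \<open>The weights \<open>N\<close> are non-decreasing, and the geometric sum with ratio at
  least 2 is dominated by its next term.\<close>

lemma sum_powers_le:
  assumes mono: "mono (N :: nat \<Rightarrow> nat)" and d: "1 \<le> d"
  shows "(\<Sum>k\<in>{g..<K}. real (N k) * 2 ^ (d * k)) \<le> real (N K) * 2 ^ (d * K)"
proof -
  have geo: "(\<Sum>k<K. (2::real) ^ (d * k)) \<le> 2 ^ (d * K)"
  proof (induction K)
    case (Suc K)
    have "(2::real) ^ 1 \<le> 2 ^ d" using d by (intro power_increasing) auto
    then have "2 * (2::real) ^ (d * K) \<le> 2 ^ d * 2 ^ (d * K)" by (intro mult_right_mono) auto
    also have "\<dots> = 2 ^ (d * Suc K)" by (simp add: power_add)
    finally show ?case using Suc by simp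
  qed simp
  have "(\<Sum>k\<in>{g..<K}. real (N k) * 2 ^ (d * k)) \<le> (\<Sum>k\<in>{g..<K}. real (N K) * 2 ^ (d * k))"
    using mono by (intro sum_mono mult_right_mono) (auto simp: monoD)
  also have "\<dots> \<le> (\<Sum>k<K. real (N K) * 2 ^ (d * k))" by (intro sum_mono2) auto
  also have "\<dots> = real (N K) * (\<Sum>k<K. 2 ^ (d * k))" by (simp add: sum_distrib_left)
  also have "\<dots> \<le> real (N K) * 2 ^ (d * K)" by (intro mult_left_mono geo) simp
  finally show ?thesis .
qed

lemma corner_mem_ccube: "(\<chi> i. real (u$i) / 2^g) \<in> ccube g u"
  by (simp add: ccube_def field_simps)

text \<open>About \<open>N k\<close> times 2 to the power \<open>d (k - g)\<close> points of
  generation \<open>k\<close> can come near the cube, with \<open>d\<close> the dimension. The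
  volume term of each cell count yields the first sum, a small proportion of all cells; the constant
  term merely counts points and is dominated by generation \<open>K\<close>.\<close>

lemma card_ccubes_near_points:
  fixes x :: "nat \<Rightarrow> real^'d"
  assumes sys: "is_system x r" and C1: "C1_seq x r N" and g: "1 \<le> g" and \<eta>: "0 < \<eta>"
  fixes u :: "nat^'d" and K j :: nat
  defines "Bad \<equiv> {v. ccube j v \<subseteq> ccube g u \<and>
      (\<exists>k\<in>{g..<K}. \<exists>p\<in>T_set x r k. ccube j v \<inter> ball_inf (x p) (r p powr (1 + \<eta>)) \<noteq> {})}"
  shows "finite Bad" "real (card Bad) \<le> 2 * 64 ^ CARD('d) *
     (2 powr (real CARD('d) * (real j - real g)) * (\<Sum>k\<in>{g..<K}. real (N k) * 2 powr (- (real CARD('d) * \<eta>) * real k))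
      + 2 powr (- real CARD('d) * real g) * (real (N K) * 2 ^ (CARD('d) * K)))"
proof -
  define c where "c = (\<chi> i. real (u$i) / 2^g)"
  define A where "A k = {p \<in> T_set x r k. x p \<in> ball_inf c (2 / 2^g)}" for k
  define \<rho> where "\<rho> k = 2 powr (- real k * (1 + \<eta>))" for k :: nat
  define Z where "Z k p = {v. ccube j v \<inter> ball_inf (x p) (\<rho> k) \<noteq> {}}" for k p
  let ?D = "CARD('d)"
  have rpos: "\<And>n. 0 < r n" using sys unfolding is_system_def by auto
  have sub: "Bad \<subseteq> (\<Union>k\<in>{g..<K}. \<Union>p\<in>A k. Z k p)"
  proof
    fix v assume "v \<in> Bad"
    then obtain k p y where v: "ccube j v \<subseteq> ccube g u" and k: "k \<in> {g..<K}" and p: "p \<in> T_set x r k"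
      and y: "y \<in> ccube j v" "linf_dist (x p) y \<le> r p powr (1 + \<eta>)"
      unfolding Bad_def ball_inf_def by blast
    have "r p powr (1 + \<eta>) \<le> (2 powr (- real k)) powr (1 + \<eta>)"
      using p \<eta> rpos[of p] by (intro powr_mono2) (auto simp: T_set_def)
    also have "\<dots> = \<rho> k" by (simp add: powr_powr \<rho>_def)
    finally have y2: "linf_dist (x p) y \<le> \<rho> k" using y(2) by simp
    then have vZ: "v \<in> Z k p" using y(1) unfolding Z_def ball_inf_def by auto
    \<comment> \<open>As \<open>k\<close> is at least \<open>g\<close>, a point whose shrunken ball
      meets the cube lies within two side lengths of the corner, where the local count
      applies.\<close>
    have "\<rho> k \<le> 2 powr (- real g)"
      unfolding \<rho>_def using k \<eta> by (intro powr_mono) (auto simp: algebra_simps intro: add_increasing2)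
    then have "linf_dist y (x p) \<le> 1 / 2^g" using y2 linf_dist_commute[of y "x p"] by (simp add: powr_real_eq_power)
    moreover have "linf_dist c y \<le> 1 / 2^g"
      using y(1) v corner_mem_ccube unfolding c_def by (blast intro: linf_dist_ccube)
    ultimately have "linf_dist c (x p) \<le> 2 / 2^g" 
      using linf_dist_triangle[of c "x p" y] unfolding numeral_2_eq_2 by simp
    then have "p \<in> A k" using p unfolding A_def ball_inf_def by simp
    then show "v \<in> (\<Union>k\<in>{g..<K}. \<Union>p\<in>A k. Z k p)" using k vZ by blast
  qed
  have A: "finite (A k)" "real (card (A k)) \<le> real (N k) * (2 * 16 ^ ?D) * 2 ^ (?D * (k - g))"
    if "k \<in> {g..<K}" for k
    unfolding A_def using card_T_set_near[OF sys C1, of k g c] that g by auto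
  have Z: "finite (Z k p)" "real (card (Z k p)) \<le> 4 ^ ?D * (1 + (\<rho> k * 2^j) ^ ?D)" for k p
    unfolding Z_def by (intro card_ccubes_meeting_ball; simp add: \<rho>_def)+
  have fin: "finite (\<Union>k\<in>{g..<K}. \<Union>p\<in>A k. Z k p)" using A(1) Z(1) by blast
  show "finite Bad" by (rule finite_subset[OF sub fin])
  have "card Bad \<le> card (\<Union>k\<in>{g..<K}. \<Union>p\<in>A k. Z k p)" by (rule card_mono[OF fin sub])
  also have "\<dots> \<le> (\<Sum>k\<in>{g..<K}. card (\<Union>p\<in>A k. Z k p))" by (rule card_UN_le) simp
  also have "\<dots> \<le> (\<Sum>k\<in>{g..<K}. \<Sum>p\<in>A k. card (Z k p))" by (intro sum_mono card_UN_le A(1))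
  finally have "real (card Bad) \<le> (\<Sum>k\<in>{g..<K}. \<Sum>p\<in>A k. real (card (Z k p)))"
    by (simp only: of_nat_sum[symmetric] of_nat_le_iff)
  also have "\<dots> \<le> (\<Sum>k\<in>{g..<K}. real (card (A k)) * (4 ^ ?D * (1 + (\<rho> k * 2^j) ^ ?D)))"
    by (intro sum_mono sum_bounded_above Z(2))
  also have "\<dots> \<le> (\<Sum>k\<in>{g..<K}. (real (N k) * (2 * 16 ^ ?D) * 2 ^ (?D * (k - g))) * (4 ^ ?D * (1 + (\<rho> k * 2^j) ^ ?D)))"
    by (intro sum_mono mult_right_mono A(2)) (auto simp: \<rho>_def)
  also have "\<dots> = (\<Sum>k\<in>{g..<K}. 2 * 64 ^ ?D *
      (2 powr (real ?D * (real j - real g)) * (real (N k) * 2 powr (- (real ?D * \<eta>) * real k))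
       + 2 powr (- real ?D * real g) * (real (N k) * 2 ^ (?D * k))))"
  proof (intro sum.cong refl)
    fix k assume k: "k \<in> {g..<K}"
    have p: "(2::real) ^ (?D * (k - g)) = 2 powr (real ?D * real k - real ?D * real g)"
      using k by (subst powr_realpow[symmetric]) (auto simp: of_nat_diff algebra_simps)
    have q: "(2::real) ^ (?D * k) = 2 powr (real ?D * real k)"
      by (subst powr_realpow[symmetric]) auto
    have "\<rho> k * 2^j = 2 powr (- real k * (1 + \<eta>) + real j)"
      unfolding \<rho>_def powr_add by (simp add: powr_realpow)
    then have s: "(\<rho> k * 2^j) ^ ?D = 2 powr (real ?D * (- real k * (1 + \<eta>) + real j))"
      by (simp add: powr_powr mult.commute flip: powr_realpow)
    have c: "(2 * 16 ^ ?D) * 4 ^ ?D = 2 * (64::real) ^ ?D" by (simp flip: power_mult_distrib)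
    have e1: "2 ^ (?D * (k - g)) * (\<rho> k * 2^j) ^ ?D
       = 2 powr (real ?D * (real j - real g)) * 2 powr (- (real ?D * \<eta>) * real k)"
      unfolding p s by (simp flip: powr_add add: algebra_simps)
    have e2: "(2::real) ^ (?D * (k - g)) = 2 powr (- real ?D * real g) * 2 ^ (?D * k)"
      unfolding p q by (simp flip: powr_add add: algebra_simps)
    have "(real (N k) * (2 * 16 ^ ?D) * 2 ^ (?D * (k - g))) * (4 ^ ?D * (1 + (\<rho> k * 2^j) ^ ?D))
      = ((2 * 16 ^ ?D) * 4 ^ ?D) * (real (N k) * (2 ^ (?D * (k - g)) * (\<rho> k * 2^j) ^ ?D) + real (N k) * 2 ^ (?D * (k - g)))"
      by algebra
    also have "\<dots> = 2 * 64 ^ ?D * (real (N k) * (2 powr (real ?D * (real j - real g)) * 2 powr (- (real ?D * \<eta>) * real k))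
       + real (N k) * (2 powr (- real ?D * real g) * 2 ^ (?D * k)))"
      unfolding c e1 unfolding e2 by (rule refl)
    finally show "(real (N k) * (2 * 16 ^ ?D) * 2 ^ (?D * (k - g))) * (4 ^ ?D * (1 + (\<rho> k * 2^j) ^ ?D))
      = 2 * 64 ^ ?D * (2 powr (real ?D * (real j - real g)) * (real (N k) * 2 powr (- (real ?D * \<eta>) * real k))
       + 2 powr (- real ?D * real g) * (real (N k) * 2 ^ (?D * k)))"
      by (simp only: mult.left_commute)
  qed
  also have "\<dots> = 2 * 64 ^ ?D *
     (2 powr (real ?D * (real j - real g)) * (\<Sum>k\<in>{g..<K}. real (N k) * 2 powr (- (real ?D * \<eta>) * real k))
      + 2 powr (- real ?D * real g) * (\<Sum>k\<in>{g..<K}. real (N k) * 2 ^ (?D * k)))"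
    by (simp only: sum_distrib_left sum.distrib distrib_left mult.assoc)
  also have "\<dots> \<le> 2 * 64 ^ ?D *
     (2 powr (real ?D * (real j - real g)) * (\<Sum>k\<in>{g..<K}. real (N k) * 2 powr (- (real ?D * \<eta>) * real k))
      + 2 powr (- real ?D * real g) * (real (N K) * 2 ^ (?D * K)))"
    using C1 unfolding C1_seq_def
    by (intro mult_left_mono add_left_mono sum_powers_le) (auto simp: Suc_leI)
  finally show "real (card Bad) \<le> 2 * 64 ^ ?D *
     (2 powr (real ?D * (real j - real g)) * (\<Sum>k\<in>{g..<K}. real (N k) * 2 powr (- (real ?D * \<eta>) * real k))
      + 2 powr (- real ?D * real g) * (real (N K) * 2 ^ (?D * K)))" .
qed

section \<open>Cubes charged by a cover of small total weight\<close>

lemma card_ccubes_meeting_set: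
  fixes A :: "(real^'d) set"
  assumes "0 \<le> \<rho>" "\<And>y z. y \<in> A \<Longrightarrow> z \<in> A \<Longrightarrow> linf_dist y z \<le> \<rho>"
  shows "finite {v. ccube j v \<inter> A \<noteq> {}}"
    "real (card {v. ccube j v \<inter> A \<noteq> {}}) \<le> 4 ^ CARD('d) * (1 + (\<rho> * 2^j) ^ CARD('d))"
proof -
  have "finite {v. ccube j v \<inter> A \<noteq> {}} \<and>
    real (card {v. ccube j v \<inter> A \<noteq> {}}) \<le> 4 ^ CARD('d) * (1 + (\<rho> * 2^j) ^ CARD('d))"
  proof (cases "A = {}")
    case False
    then obtain a where a: "a \<in> A" by blast
    have sub: "{v. ccube j v \<inter> A \<noteq> {}} \<subseteq> {v. ccube j v \<inter> ball_inf a \<rho> \<noteq> {}}"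
      using assms(2)[OF a] unfolding ball_inf_def by auto
    note B = card_ccubes_meeting_ball[OF assms(1), of j a]
    show ?thesis using finite_subset[OF sub B(1)] card_mono[OF B(1) sub] B(2) by linarith
  qed (use assms(1) in simp)
  then show "finite {v. ccube j v \<inter> A \<noteq> {}}"
    "real (card {v. ccube j v \<inter> A \<noteq> {}}) \<le> 4 ^ CARD('d) * (1 + (\<rho> * 2^j) ^ CARD('d))" by auto
qed

text \<open>The quantity kept small along the nested cubes: once it drops below
  \<open>a i powr s\<close>, the set \<open>A i\<close> cannot meet \<open>Z\<close>.\<close>

definition hitting_sum :: "(nat \<Rightarrow> (real^'d) set) \<Rightarrow> (nat \<Rightarrow> real) \<Rightarrow> real \<Rightarrow> (real^'d) set \<Rightarrow> real" where
  "hitting_sum A a s Z = (\<Sum>i. if A i \<inter> Z \<noteq> {} then a i powr s else 0)"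

locale small_cover =
  fixes A :: "nat \<Rightarrow> (real^'d) set" and a :: "nat \<Rightarrow> real" and s :: real
  assumes a_pos: "\<And>i. 0 < a i"
    and diam: "\<And>i y z. y \<in> A i \<Longrightarrow> z \<in> A i \<Longrightarrow> linf_dist y z \<le> a i"
    and summ: "summable (\<lambda>i. a i powr s)"
    and s_pos: "0 < s" and s_le: "s \<le> real CARD('d)"
begin

lemma summable_restrict: "summable (\<lambda>i. if P i then a i powr s else 0)"
  by (rule summable_comparison_test[OF _ summ]) auto

lemma hitting_sum_le: "hitting_sum A a s Z \<le> (\<Sum>i. a i powr s)"
  unfolding hitting_sum_def by (intro suminf_le summable_restrict summ) auto

lemma finite_large: "0 < t \<Longrightarrow> finite {i. t \<le> a i}"
proof -
  assume t: "0 < t"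
  have "(\<lambda>i. a i powr s) \<longlonglongrightarrow> 0" by (rule summable_LIMSEQ_zero[OF summ])
  then have "\<forall>\<^sub>F i in sequentially. a i powr s < t powr s" using t by (intro order_tendstoD(2)) auto
  then obtain n where n: "\<And>i. i \<ge> n \<Longrightarrow> a i powr s < t powr s" unfolding eventually_sequentially by blast
  have "{i. t \<le> a i} \<subseteq> {..<n}"
  proof
    fix i assume "i \<in> {i. t \<le> a i}"
    then have "t powr s \<le> a i powr s" using t s_pos by (intro powr_mono2) auto
    then show "i \<in> {..<n}" using n[of i] by (force simp: not_less)
  qed
  then show ?thesis by (rule finite_subset) simp
qed

lemma hit_le_hitting_sum:
  assumes "A i \<inter> Z \<noteq> {}"
  shows "a i powr s \<le> hitting_sum A a s Z"
  unfolding hitting_sum_def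
  using sum_le_suminf[OF summable_restrict[of "\<lambda>i. A i \<inter> Z \<noteq> {}"], of "{i}"] assms by simp

text \<open>As \<open>c \<le> 1\<close>, any set of the cover meeting the parent has size at most
  \<open>2 powr (- real g)\<close>. A set at least as large as a cell meets a number of cells of
  order \<open>(a i * 2^j) ^ CARD('d)\<close>. Since \<open>s\<close> is at most the dimension, this
  is bounded by a multiple of \<open>a i powr s\<close>, and summing reproduces the hitting
  sum.\<close>

lemma card_meeting_large:
  assumes h: "hitting_sum A a s (ccube g u) < c * 2 powr (- real g * s)" and c: "c \<le> 1"
  shows "finite {v. ccube j v \<subseteq> ccube g u \<and> (\<exists>i. 1 / 2^j \<le> a i \<and> A i \<inter> ccube j v \<noteq> {})}" (is "finite ?B")
    "real (card {v. ccube j v \<subseteq> ccube g u \<and> (\<exists>i. 1 / 2^j \<le> a i \<and> A i \<inter> ccube j v \<noteq> {})})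
      \<le> 2 * 4 ^ CARD('d) * c * 2 powr (real CARD('d) * (real j - real g))"
proof -
  let ?D = "CARD('d)"
  define I where "I = {i. 1 / 2^j \<le> a i \<and> A i \<inter> ccube g u \<noteq> {}}"
  define Z where "Z i = {v. ccube j v \<inter> A i \<noteq> {}}" for i
  have finI: "finite I" by (rule finite_subset[OF _ finite_large[of "1 / 2^j"]]) (auto simp: I_def)
  have Z: "finite (Z i)" "real (card (Z i)) \<le> 4 ^ ?D * (1 + (a i * 2^j) ^ ?D)" for i
    unfolding Z_def using card_ccubes_meeting_set[OF less_imp_le[OF a_pos] diam] by blast+
  have sub: "?B \<subseteq> (\<Union>i\<in>I. Z i)" unfolding I_def Z_def by blast
  have finU: "finite (\<Union>i\<in>I. Z i)" using finI Z(1) by blast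
  show "finite ?B" by (rule finite_subset[OF sub finU])
  have ci: "real (card (Z i)) \<le> 2 * 4 ^ ?D * 2 powr (real ?D * real j - real g * (real ?D - s)) * a i powr s" if i: "i \<in> I" for i
  proof -
    have "a i powr s < c * 2 powr (- real g * s)"
      using hit_le_hitting_sum[of i "ccube g u"] i h unfolding I_def by auto
    also have "\<dots> \<le> 1 * 2 powr (- real g * s)" using c by (intro mult_right_mono) auto
    also have "\<dots> = (2 powr (- real g)) powr s" by (simp add: powr_powr)
    finally have "a i powr s < (2 powr (- real g)) powr s" .
    then have ag: "a i \<le> 2 powr (- real g)"
      using powr_mono2[of s "2 powr (- real g)" "a i"] s_pos by force
    have "1 \<le> a i * 2^j" using i unfolding I_def by (auto simp: field_simps)
    then have "1 \<le> (a i * 2^j) ^ ?D" by (rule one_le_power)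
    then have "real (card (Z i)) \<le> 4 ^ ?D * (2 * (a i * 2^j) ^ ?D)"
      using Z(2)[of i] by (simp add: order_trans[OF _ mult_left_mono])
    also have "(a i * 2^j) ^ ?D = 2 powr (real ?D * real j) * (a i powr (real ?D - s) * a i powr s)"
      using a_pos[of i] by (simp add: power_mult_distrib powr_powr mult.commute flip: powr_realpow powr_add)
    also have "4 ^ ?D * (2 * (2 powr (real ?D * real j) * (a i powr (real ?D - s) * a i powr s)))
        \<le> 4 ^ ?D * (2 * (2 powr (real ?D * real j) * ((2 powr (- real g)) powr (real ?D - s) * a i powr s)))"
      using ag a_pos[of i] s_le by (intro mult_left_mono mult_right_mono powr_mono2) auto
    also have "(2 powr (- real g)) powr (real ?D - s) = 2 powr (- real g * (real ?D - s))" by (simp add: powr_powr)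
    finally have "real (card (Z i)) \<le> 4 ^ ?D * (2 * (2 powr (real ?D * real j) * (2 powr (- real g * (real ?D - s)) * a i powr s)))" .
    also have "4 ^ ?D * (2 * (2 powr (real ?D * real j) * (2 powr (- real g * (real ?D - s)) * a i powr s)))
        = 2 * 4 ^ ?D * (2 powr (real ?D * real j) * 2 powr (- real g * (real ?D - s))) * a i powr s"
      by (simp only: mult_ac)
    also have "2 powr (real ?D * real j) * 2 powr (- real g * (real ?D - s)) = 2 powr (real ?D * real j - real g * (real ?D - s))"
      by (simp flip: powr_add)
    finally show ?thesis .
  qed
  have "card ?B \<le> card (\<Union>i\<in>I. Z i)" by (rule card_mono[OF finU sub])
  also have "\<dots> \<le> (\<Sum>i\<in>I. card (Z i))" by (rule card_UN_le[OF finI])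
  finally have "real (card ?B) \<le> (\<Sum>i\<in>I. real (card (Z i)))" by (simp only: of_nat_sum[symmetric] of_nat_le_iff)
  also have "\<dots> \<le> (\<Sum>i\<in>I. 2 * 4 ^ ?D * 2 powr (real ?D * real j - real g * (real ?D - s)) * a i powr s)"
    by (intro sum_mono ci)
  also have "\<dots> = 2 * 4 ^ ?D * 2 powr (real ?D * real j - real g * (real ?D - s)) * (\<Sum>i\<in>I. a i powr s)"
    by (simp only: sum_distrib_left)
  also have "(\<Sum>i\<in>I. a i powr s) = (\<Sum>i\<in>I. if A i \<inter> ccube g u \<noteq> {} then a i powr s else 0)"
    by (intro sum.cong) (auto simp: I_def)
  also have "\<dots> \<le> hitting_sum A a s (ccube g u)"
    unfolding hitting_sum_def by (intro sum_le_suminf summable_restrict finI) auto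
  also have "\<dots> \<le> c * 2 powr (- real g * s)" using h by simp
  finally have "real (card ?B) \<le> 2 * 4 ^ ?D * 2 powr (real ?D * real j - real g * (real ?D - s)) * (c * 2 powr (- real g * s))"
    by simp
  also have "\<dots> = 2 * 4 ^ ?D * c * (2 powr (real ?D * real j - real g * (real ?D - s)) * 2 powr (- real g * s))"
    by (simp only: mult_ac)
  also have "2 powr (real ?D * real j - real g * (real ?D - s)) * 2 powr (- real g * s) = 2 powr (real ?D * (real j - real g))"
    by (simp flip: powr_add add: algebra_simps)
  finally show "real (card ?B) \<le> 2 * 4 ^ ?D * c * 2 powr (real ?D * (real j - real g))" .
qed

text \<open>A Markov inequality: a set smaller than a cell meets at most
  \<open>2 * 4 ^ CARD('d)\<close> cells, so the total charge over all cells is at most that multiple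
  of the hitting sum of the parent.\<close>

lemma card_heavily_hit:
  assumes h: "hitting_sum A a s (ccube g u) < c * 2 powr (- real g * s)" and c: "0 \<le> c"
    and fin: "finite Q" and sub: "\<And>v. v \<in> Q \<Longrightarrow> ccube j v \<subseteq> ccube g u"
  shows "\<tau> * real (card {v\<in>Q. \<tau> \<le> (\<Sum>i. if a i < 1 / 2^j \<and> A i \<inter> ccube j v \<noteq> {} then a i powr s else 0)})
      \<le> 2 * 4 ^ CARD('d) * c"
proof -
  let ?D = "CARD('d)"
  define F where "F v i = (if a i < 1 / 2^j \<and> A i \<inter> ccube j v \<noteq> {} then a i powr s else 0)" for v i
  define B where "B = {v\<in>Q. \<tau> \<le> (\<Sum>i. F v i)}"
  have finB: "finite B" unfolding B_def using fin by simp
  have smF: "summable (F v)" for v unfolding F_def by (rule summable_restrict)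
  have pt: "(\<Sum>v\<in>B. F v i) \<le> 2 * 4 ^ ?D * (if A i \<inter> ccube g u \<noteq> {} then a i powr s else 0)" for i
  proof (cases "a i < 1 / 2^j \<and> A i \<inter> ccube g u \<noteq> {}")
    case True
    let ?Z = "{v. ccube j v \<inter> A i \<noteq> {}}"
    note Z = card_ccubes_meeting_set[of "a i" "A i" j, OF less_imp_le[OF a_pos] diam]
    have "a i * 2^j \<le> 1" using True by (simp add: field_simps)
    then have "(a i * 2^j) ^ ?D \<le> 1" using a_pos[of i] by (intro power_le_one) auto
    then have "4 ^ ?D * (1 + (a i * 2^j) ^ ?D) \<le> 4 ^ ?D * 2" by (intro mult_left_mono) auto
    then have cZ: "real (card ?Z) \<le> 2 * 4 ^ ?D" using Z(2) by linarith
    have "(\<Sum>v\<in>B. F v i) = (\<Sum>v\<in>B \<inter> ?Z. F v i)"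
      by (rule sum.mono_neutral_right) (use finB in \<open>auto simp: F_def\<close>)
    also have "\<dots> \<le> real (card (B \<inter> ?Z)) * a i powr s"
      by (rule sum_bounded_above) (simp add: F_def)
    also have "\<dots> \<le> real (card ?Z) * a i powr s"
      using card_mono[OF Z(1), of "B \<inter> ?Z"] by (intro mult_right_mono) auto
    also have "\<dots> \<le> 2 * 4 ^ ?D * a i powr s" using cZ by (intro mult_right_mono) auto
    finally show ?thesis using True by simp
  next
    case False
    have "F v i = 0" if "v \<in> B" for v
      using False sub[of v] that unfolding F_def B_def by auto
    then show ?thesis by simp
  qed
  have "\<tau> * real (card B) \<le> (\<Sum>v\<in>B. \<Sum>i. F v i)"
    using sum_bounded_below[of B \<tau> "\<lambda>v. \<Sum>i. F v i"] by (simp add: B_def mult.commute)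
  also have "\<dots> = (\<Sum>i. \<Sum>v\<in>B. F v i)" by (rule suminf_sum[symmetric]) (rule smF)
  also have "\<dots> \<le> (\<Sum>i. 2 * 4 ^ ?D * (if A i \<inter> ccube g u \<noteq> {} then a i powr s else 0))"
    by (intro suminf_le pt summable_sum smF summable_mult summable_restrict)
  also have "\<dots> = 2 * 4 ^ ?D * hitting_sum A a s (ccube g u)"
    unfolding hitting_sum_def by (intro suminf_mult summable_restrict)
  also have "\<dots> \<le> 2 * 4 ^ ?D * (c * 2 powr (- real g * s))"
    using h by (intro mult_left_mono) auto
  also have "\<dots> \<le> 2 * 4 ^ ?D * (c * 1)"
    using c s_pos powr_mono[of "- real g * s" 0 2] by (intro mult_left_mono) auto
  finally show ?thesis unfolding B_def F_def by simp
qed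

end

section \<open>Selecting a good child of a cube\<close>

locale C2_system =
  fixes x :: "nat \<Rightarrow> real^'d" and r :: "nat \<Rightarrow> real" and \<phi> :: "real \<Rightarrow> real" and N :: "nat \<Rightarrow> nat"
    and \<kappa> :: "real \<Rightarrow> real" and \<Delta> :: "real set"
  assumes sys: "is_system x r" and Phi: "In_Phi \<phi>" and C1: "C1_seq x r N"
    and \<kappa>_cont: "continuous_on {1<..} \<kappa>" and \<kappa>_pos: "\<And>\<delta>. 1 < \<delta> \<Longrightarrow> 0 < \<kappa> \<delta>" and \<kappa>_le: "\<And>\<delta>. 1 < \<delta> \<Longrightarrow> \<kappa> \<delta> \<le> 1"
    and \<Delta>: "\<Delta> \<subseteq> {1<..}" "{1<..} \<subseteq> closure \<Delta>"
    and many: "\<And>\<delta> g u. \<delta> \<in> \<Delta> \<Longrightarrow> 1 \<le> g \<Longrightarrow> valid_dyadic g u \<Longrightarrow>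
        infinite {j. g \<le> j \<and>
          real (card (Q_set x r N \<phi> g u j \<delta>)) \<ge> \<kappa> \<delta> * 2 powr (real CARD('d) * (real j - real g))}"
begin

text \<open>Nearness to \<open>x m\<close> pushes the rate up, and the last two clauses keep it
  down. They meet at \<open>gamma\<close> of \<open>j\<close>: from there to the size of the child
  the isolation in \<open>P_prop\<close> acts, while between the parent and \<open>gamma\<close> the
  discarded cells do. The bound on \<open>g'\<close> leaves no gap between successive
  children.\<close>

definition good_child :: "real \<Rightarrow> real \<Rightarrow> nat \<Rightarrow> (real^'d) set \<Rightarrow> nat \<Rightarrow> nat \<Rightarrow> nat \<Rightarrow> (real^'d) set \<Rightarrow> bool" where
  "good_child \<eta> \<delta> g Z j m g' Z' \<longleftrightarrow> Z' \<subseteq> Z \<and> j < g' \<and> real g' \<le> real_of_int \<lfloor>\<delta> * (real j + 1)\<rfloor> + 4 \<and>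
     2 powr (-(real j + 1)) \<le> r m \<and> r m < 2 powr (- real j) \<and>
     (\<forall>y\<in>Z'. linf_dist y (x m) \<le> r m powr \<delta>) \<and>
     (\<forall>y\<in>Z'. \<forall>p. real (gamma CARD('d) N \<phi> j) \<le> - log 2 (r p) \<longrightarrow>
        - log 2 (r p) < real_of_int \<lfloor>\<delta> * (real j + 1)\<rfloor> + 4 \<longrightarrow>
        2 powr (- (\<delta> * (real j + 1) + 4)) \<le> linf_dist y (x p)) \<and>
     (\<forall>y\<in>Z'. \<forall>p. first_occ x p \<longrightarrow> real g \<le> - log 2 (r p) \<longrightarrow>
        - log 2 (r p) < real (gamma CARD('d) N \<phi> j) \<longrightarrow> r p powr (1 + \<eta>) < linf_dist y (x p))"

text \<open>Because \<open>s * M\<close> is below the dimension, the number of cells eventually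
  outgrows the reciprocal of the charge that a child may carry.\<close>

lemma eventually_large_generation:
  assumes M: "s * M < real CARD('d)" and c: "0 < c'"
  shows "\<forall>\<^sub>F j in sequentially. 2 powr (s * (M * (real j + 1) + 4)) / c' \<le> 2 powr (real CARD('d) * (real j - real g))"
proof -
  have "0 < real CARD('d) - s * M" using M by simp
  then have "filterlim (\<lambda>j. (real CARD('d) - s * M) * real j) at_top sequentially"
    by (intro filterlim_tendsto_pos_mult_at_top[OF tendsto_const _ filterlim_real_sequentially])
  then have "\<forall>\<^sub>F j in sequentially. real CARD('d) * real g + s * M + 4 * s - log 2 c' \<le> (real CARD('d) - s * M) * real j"
    unfolding filterlim_at_top by blast
  then show ?thesis
  proof eventually_elim
    case (elim j)
    have "2 powr (s * (M * (real j + 1) + 4)) / c' = 2 powr (s * (M * (real j + 1) + 4) - log 2 c')"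
      using c by (simp add: powr_diff)
    also have "\<dots> \<le> 2 powr (real CARD('d) * (real j - real g))"
      using elim by (intro powr_mono) (auto simp: algebra_simps)
    finally show ?case .
  qed
qed

text \<open>A count in generation \<open>j\<close>. At least \<open>\<kappa>\<^sub>0 * X\<close>
  cells have the property \<open>P_prop\<close>, and the three kinds of bad cells take up at most a
  quarter, an eighth and an eighth of that number, so half of the cells survive.\<close>

lemma good_child_exists:
  assumes cov: "small_cover A a s" and sM: "s * M < real CARD('d)"
    and \<delta>: "\<delta> \<in> \<Delta>" "\<delta> \<le> M" and \<kappa>0: "0 < \<kappa>\<^sub>0" "\<kappa>\<^sub>0 \<le> \<kappa> \<delta>"
    and \<eta>: "0 < \<eta>" and c': "0 < c'" and g: "1 \<le> g" and u: "valid_dyadic g u"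
    and tail: "\<And>K. 2 * 64 ^ CARD('d) * (\<Sum>k\<in>{g..<K}. real (N k) * 2 powr (- (real CARD('d) * \<eta>) * real k)) \<le> \<kappa>\<^sub>0 / 8"
    and hit: "hitting_sum A a s (ccube g u) < \<kappa>\<^sub>0 / (16 * 4 ^ CARD('d)) * 2 powr (- real g * s)"
  shows "\<exists>j m g' u'. J \<le> j \<and> valid_dyadic g' u' \<and> good_child \<eta> \<delta> g (ccube g u) j m g' (ccube g' u') \<and>
    hitting_sum A a s (ccube g' u') < c' * 2 powr (- real g' * s)"
proof -
  interpret small_cover A a s by fact
  let ?D = "CARD('d)"
  define C where "C = 2 * (64::real) ^ ?D"
  define c where "c = \<kappa>\<^sub>0 / (16 * 4 ^ ?D)"
  have Cpos: "0 < C" unfolding C_def by simp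
  have \<delta>1: "1 < \<delta>" using \<delta> \<Delta> by auto
  have "\<kappa>\<^sub>0 \<le> 1" using \<kappa>0 \<kappa>_le[OF \<delta>1] by simp
  moreover have "1 \<le> 16 * (4::real) ^ ?D" using one_le_power[of "4::real" ?D] by linarith
  ultimately have c: "0 < c" "c \<le> 1" unfolding c_def using \<kappa>0 by (auto simp: field_simps)
  have D1: "1 \<le> ?D" by (simp add: Suc_leI)
  have e1: "\<forall>\<^sub>F j in sequentially. real (N (gamma ?D N \<phi> j)) * 2 powr (real ?D * real (gamma ?D N \<phi> j))
        \<le> 2 powr (- real ?D * real j * \<phi> (2 powr (- real j))) * 2 powr (real ?D * real j)"
    using gamma_properties[OF Phi C1 D1, of "1/2"] by (auto elim: eventually_mono)
  have e2: "\<forall>\<^sub>F j in sequentially. 2 powr (- real j * \<phi> (2 powr (- real j))) < \<kappa>\<^sub>0 / (8 * C)"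
    using \<kappa>0 Cpos by (intro order_tendstoD(2)[OF Phi_power_tendsto_0[OF Phi]]) simp
  have e3: "\<forall>\<^sub>F j in sequentially. 2 powr (s * (M * (real j + 1) + 4)) / c' \<le> 2 powr (real ?D * (real j - real g))"
    by (rule eventually_large_generation[OF sM c'])
  have "\<forall>\<^sub>F j in sequentially. J \<le> j \<and>
      real (N (gamma ?D N \<phi> j)) * 2 powr (real ?D * real (gamma ?D N \<phi> j))
        \<le> 2 powr (- real ?D * real j * \<phi> (2 powr (- real j))) * 2 powr (real ?D * real j) \<and>
      2 powr (- real j * \<phi> (2 powr (- real j))) < \<kappa>\<^sub>0 / (8 * C) \<and>
      2 powr (s * (M * (real j + 1) + 4)) / c' \<le> 2 powr (real ?D * (real j - real g))"
    using e1 e2 e3 eventually_ge_at_top[of J] by eventually_elim blast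
  then obtain n0 where n0: "\<And>j. j \<ge> n0 \<Longrightarrow> J \<le> j \<and>
      real (N (gamma ?D N \<phi> j)) * 2 powr (real ?D * real (gamma ?D N \<phi> j))
        \<le> 2 powr (- real ?D * real j * \<phi> (2 powr (- real j))) * 2 powr (real ?D * real j) \<and>
      2 powr (- real j * \<phi> (2 powr (- real j))) < \<kappa>\<^sub>0 / (8 * C) \<and>
      2 powr (s * (M * (real j + 1) + 4)) / c' \<le> 2 powr (real ?D * (real j - real g))"
    unfolding eventually_sequentially by blast
  obtain j where jn: "n0 \<le> j" and gj: "g \<le> j"
    and card: "real (card (Q_set x r N \<phi> g u j \<delta>)) \<ge> \<kappa> \<delta> * 2 powr (real ?D * (real j - real g))"
    using many[OF \<delta>(1) g u] unfolding infinite_nat_iff_unbounded_le mem_Collect_eq by metis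
  have J: "J \<le> j" and gam: "real (N (gamma ?D N \<phi> j)) * 2 powr (real ?D * real (gamma ?D N \<phi> j))
        \<le> 2 powr (- real ?D * real j * \<phi> (2 powr (- real j))) * 2 powr (real ?D * real j)"
    and ph: "2 powr (- real j * \<phi> (2 powr (- real j))) < \<kappa>\<^sub>0 / (8 * C)"
    and big: "2 powr (s * (M * (real j + 1) + 4)) / c' \<le> 2 powr (real ?D * (real j - real g))"
    using n0[OF jn] by auto
  define X where "X = 2 powr (real ?D * (real j - real g))"
  define K where "K = gamma ?D N \<phi> j"
  define Q where "Q = Q_set x r N \<phi> g u j \<delta>"
  have Xpos: "0 < X" unfolding X_def by simp
  have cardQ: "\<kappa>\<^sub>0 * X \<le> real (card Q)"
    using card mult_right_mono[OF \<kappa>0(2), of X] Xpos unfolding Q_def X_def by linarith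
  \<comment> \<open>An infinite set has \<open>card\<close> equal to 0, so the positive lower bound
    also yields finiteness.\<close>
  then have "card Q \<noteq> 0" using mult_pos_pos[OF \<kappa>0(1) Xpos] by linarith
  then have finQ: "finite Q" by (intro card_ge_0_finite) simp
  have subQ: "ccube j v \<subseteq> ccube g u" if "v \<in> Q" for v
    using that ccube_subset_of_dcube_subset unfolding Q_def Q_set_def by blast
  define B1 where "B1 = {v. ccube j v \<subseteq> ccube g u \<and>
      (\<exists>k\<in>{g..<K}. \<exists>p\<in>T_set x r k. ccube j v \<inter> ball_inf (x p) (r p powr (1 + \<eta>)) \<noteq> {})}"
  define B2 where "B2 = {v. ccube j v \<subseteq> ccube g u \<and> (\<exists>i. 1 / 2^j \<le> a i \<and> A i \<inter> ccube j v \<noteq> {})}"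
  \<comment> \<open>The child will have generation at most \<open>M * (j + 1) + 4\<close>, so a
    charge below \<open>\<tau>\<close> meets its requirement.\<close>
  define \<tau> where "\<tau> = c' * 2 powr (- s * (M * (real j + 1) + 4))"
  define B3 where "B3 = {v\<in>Q. \<tau> \<le> (\<Sum>i. if a i < 1 / 2^j \<and> A i \<inter> ccube j v \<noteq> {} then a i powr s else 0)}"
  have \<tau>: "0 < \<tau>" unfolding \<tau>_def using c' by simp
  have "1 / \<tau> = 2 powr (s * (M * (real j + 1) + 4)) / c'"
    unfolding \<tau>_def mult_minus_left powr_minus by (simp add: divide_simps)
  then have "1 / \<tau> \<le> X" using big unfolding X_def by simp
  then have "1 \<le> \<tau> * X" using \<tau> by (simp add: field_simps)
  \<comment> \<open>One eighth comes from the assumed tail bound, the other from the choice of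
    \<open>gamma\<close> together with the decay in \<open>ph\<close>.\<close>
  have b1: "finite B1" "real (card B1) \<le> \<kappa>\<^sub>0 / 4 * X"
  proof -
    note B = card_ccubes_near_points[OF sys C1 g \<eta>, of j u K]
    show "finite B1" unfolding B1_def by (rule B(1))
    have \<phi>0: "0 \<le> \<phi> (2 powr (- real j))" using Phi unfolding In_Phi_def by simp
    have "2 powr (- real g * real ?D) * (real (N K) * 2 ^ (?D * K)) \<le>
        2 powr (- real g * real ?D) * (2 powr (- real ?D * real j * \<phi> (2 powr (- real j))) * 2 powr (real ?D * real j))"
      using gam unfolding K_def by (intro mult_left_mono) (simp_all flip: powr_realpow)
    also have "\<dots> = 2 powr (- real ?D * real j * \<phi> (2 powr (- real j))) * X"
      unfolding X_def by (simp flip: powr_add add: algebra_simps)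
    also have "\<dots> \<le> 2 powr (- real j * \<phi> (2 powr (- real j))) * X"
      using \<phi>0 D1 Xpos by (intro mult_right_mono powr_mono) (auto simp: mult_le_cancel_right1 mult_nonneg_nonneg mult.assoc)
    also have "\<dots> \<le> \<kappa>\<^sub>0 / (8 * C) * X" using ph Xpos by (intro mult_right_mono) auto
    finally have "C * (2 powr (- real g * real ?D) * (real (N K) * 2 ^ (?D * K))) \<le> C * (\<kappa>\<^sub>0 / (8 * C) * X)"
      using Cpos by (intro mult_left_mono) auto
    also have "\<dots> = \<kappa>\<^sub>0 / 8 * X" using Cpos by simp
    finally have p2: "C * (2 powr (- real g * real ?D) * (real (N K) * 2 ^ (?D * K))) \<le> \<kappa>\<^sub>0 / 8 * X" .
    have p1: "(C * (\<Sum>k\<in>{g..<K}. real (N k) * 2 powr (- (real ?D * \<eta>) * real k))) * X \<le> \<kappa>\<^sub>0 / 8 * X"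
      using tail[of K] Xpos unfolding C_def by (intro mult_right_mono) auto
    have "real (card B1) \<le> C * (X * (\<Sum>k\<in>{g..<K}. real (N k) * 2 powr (- (real ?D * \<eta>) * real k))
      + 2 powr (- real g * real ?D) * (real (N K) * 2 ^ (?D * K)))"
      using B(2) unfolding B1_def C_def X_def by (simp add: mult.commute)
    also have "\<dots> = (C * (\<Sum>k\<in>{g..<K}. real (N k) * 2 powr (- (real ?D * \<eta>) * real k))) * X
        + C * (2 powr (- real g * real ?D) * (real (N K) * 2 ^ (?D * K)))" by algebra
    finally show "real (card B1) \<le> \<kappa>\<^sub>0 / 4 * X" using p1 p2 by linarith
  qed
  have hit': "hitting_sum A a s (ccube g u) < c * 2 powr (- real g * s)" using hit unfolding c_def .
  have c8: "2 * 4 ^ ?D * c = \<kappa>\<^sub>0 / 8" unfolding c_def by simp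
  have b2: "finite B2" "real (card B2) \<le> \<kappa>\<^sub>0 / 8 * X"
    using card_meeting_large[OF hit' c(2), of j] unfolding B2_def X_def c8 by auto
  have b3: "finite B3" "real (card B3) \<le> \<kappa>\<^sub>0 / 8 * X"
  proof -
    show "finite B3" unfolding B3_def using finQ by simp
    have "\<tau> * real (card B3) \<le> \<kappa>\<^sub>0 / 8"
      using card_heavily_hit[OF hit' less_imp_le[OF c(1)] finQ subQ, of \<tau>] unfolding B3_def c8 by simp
    also have "\<dots> \<le> \<kappa>\<^sub>0 / 8 * (\<tau> * X)" using \<kappa>0 \<open>1 \<le> \<tau> * X\<close> by (simp add: mult_le_cancel_left1)
    finally have "\<tau> * real (card B3) \<le> \<tau> * (\<kappa>\<^sub>0 / 8 * X)" by (simp add: mult_ac)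
    then show "real (card B3) \<le> \<kappa>\<^sub>0 / 8 * X" using \<tau> by simp
  qed
  have "\<not> Q \<subseteq> B1 \<union> B2 \<union> B3"
  proof
    assume "Q \<subseteq> B1 \<union> B2 \<union> B3"
    then have "card Q \<le> card (B1 \<union> B2 \<union> B3)" using b1 b2 b3 by (intro card_mono) auto
    also have "\<dots> \<le> card B1 + card B2 + card B3"
      using card_Un_le[of "B1 \<union> B2" B3] card_Un_le[of B1 B2] by linarith
    finally have "real (card Q) \<le> real (card B1) + real (card B2) + real (card B3)" by linarith
    then have "\<kappa>\<^sub>0 * X \<le> \<kappa>\<^sub>0 / 2 * X" using b1 b2 b3 cardQ by linarith
    then show False using mult_pos_pos[OF \<kappa>0(1) Xpos] by linarith
  qed
  then obtain v where v: "v \<in> Q" "v \<notin> B1" "v \<notin> B2" "v \<notin> B3" by blast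
  have vQ: "valid_dyadic j v" "P_prop x r N \<phi> j v \<delta>" using v(1) unfolding Q_def Q_set_def by auto
  obtain m g' u' where w: "valid_dyadic g' u'" "ccube g' u' \<subseteq> ccube j v" "j < g'"
    "real g' \<le> real_of_int \<lfloor>\<delta> * (real j + 1)\<rfloor> + 4" "real g' \<le> \<delta> * (real j + 1) + 4"
    "2 powr (-(real j + 1)) \<le> r m" "r m < 2 powr (- real j)"
    and near: "\<And>y. y \<in> ccube g' u' \<Longrightarrow> linf_dist y (x m) \<le> r m powr \<delta>"
    and far: "\<And>y p. y \<in> ccube g' u' \<Longrightarrow> real (gamma CARD('d) N \<phi> j) \<le> - log 2 (r p) \<Longrightarrow>
        - log 2 (r p) < real_of_int \<lfloor>\<delta> * (real j + 1)\<rfloor> + 4 \<Longrightarrow>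
        2 powr (- (\<delta> * (real j + 1) + 4)) \<le> linf_dist y (x p)"
    by (rule child_cube[OF sys vQ \<delta>1]) blast
  have rpos: "\<And>n. 0 < r n" using sys unfolding is_system_def by auto
  \<comment> \<open>The generation of such a \<open>p\<close> lies in \<open>{g..<K}\<close>, so the
    chosen cell, not being in \<open>B1\<close>, avoids its shrunken ball.\<close>
  have far2: "r p powr (1 + \<eta>) < linf_dist y (x p)"
    if y: "y \<in> ccube g' u'" and p: "first_occ x p" "real g \<le> - log 2 (r p)" "- log 2 (r p) < real K" for y p
  proof -
    have "log 2 (r p) \<le> 0" using p(2) by linarith
    then have "r p \<le> 1" using rpos[of p] by simp
    from generation_of_radius[OF rpos this] obtain k where k: "real k \<le> - log 2 (r p)"
      "- log 2 (r p) < real k + 1" "2 powr (-(real k + 1)) < r p" "r p \<le> 2 powr (- real k)" by blast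
    have kT: "p \<in> T_set x r k" using k p(1) unfolding T_set_def by simp
    have kr: "k \<in> {g..<K}" using k p by simp
    have "y \<in> ccube j v" using y w(2) by blast
    then have "y \<notin> ball_inf (x p) (r p powr (1 + \<eta>))"
      using v(1,2) subQ kT kr unfolding B1_def by blast
    then show ?thesis unfolding ball_inf_def using linf_dist_commute[of y "x p"] by simp
  qed
  \<comment> \<open>A set meeting the child meets the cell \<open>v\<close>, and as \<open>v\<close>
    is not in \<open>B2\<close> it is smaller than that cell; its weight is thus counted in the sum
    defining \<open>B3\<close>.\<close>
  have "hitting_sum A a s (ccube g' u') \<le> (\<Sum>i. if a i < 1 / 2^j \<and> A i \<inter> ccube j v \<noteq> {} then a i powr s else 0)"
    unfolding hitting_sum_def
  proof (intro suminf_le summable_restrict)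
    fix i
    show "(if A i \<inter> ccube g' u' \<noteq> {} then a i powr s else 0)
        \<le> (if a i < 1 / 2^j \<and> A i \<inter> ccube j v \<noteq> {} then a i powr s else 0)"
    proof (cases "A i \<inter> ccube g' u' \<noteq> {}")
      case True
      then have "A i \<inter> ccube j v \<noteq> {}" using w(2) by blast
      moreover from this have "a i < 1 / 2^j"
        using v(3) subQ[OF v(1)] unfolding B2_def by (force simp: not_le[symmetric])
      ultimately show ?thesis by simp
    qed simp
  qed
  also have "\<dots> < \<tau>" using v(1,4) unfolding B3_def by auto
  also have "\<tau> \<le> c' * 2 powr (- real g' * s)"
  proof -
    have "\<delta> * (real j + 1) \<le> M * (real j + 1)" using \<delta>(2) by (intro mult_right_mono) auto
    then have "real g' \<le> M * (real j + 1) + 4" using w(5) by linarith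
    then have "s * real g' \<le> s * (M * (real j + 1) + 4)" using s_pos by (intro mult_left_mono) auto
    then show ?thesis unfolding \<tau>_def using c' by (intro mult_left_mono powr_mono) (auto simp: mult.commute)
  qed
  finally have "hitting_sum A a s (ccube g' u') < c' * 2 powr (- real g' * s)" .
  moreover have "good_child \<eta> \<delta> g (ccube g u) j m g' (ccube g' u')"
    unfolding good_child_def using w subQ[OF v(1)] near far far2 unfolding K_def by blast
  ultimately show ?thesis using J w(1) by blast
qed

end

section \<open>The limit point and the lower bound\<close>

lemma compact_ccube: "compact (ccube j (v :: nat^'d))"
proof -
  have "ccube j v = cbox (\<chi> i. real (v$i) / 2^j) (\<chi> i. (real (v$i) + 1) / 2^j)"
    by (auto simp: ccube_def mem_box_cart)
  then show ?thesis by simp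
qed

lemma open_contains_ccube:
  fixes W :: "(real^'d) set"
  assumes W: "open W" "W \<subseteq> open_cube01" "W \<noteq> {}"
  obtains g u where "J \<le> g" "valid_dyadic g u" "ccube g u \<subseteq> W"
proof -
  obtain y where y: "y \<in> W" using W(3) by blast
  then obtain e where e: "e > 0" "ball y e \<subseteq> W" using W(1) open_contains_ball by blast
  have "(\<lambda>g. real CARD('d) * (1 / 2^g)) \<longlonglongrightarrow> 0" by real_asymp
  then have "\<forall>\<^sub>F g in sequentially. real CARD('d) * (1 / 2^g) < e"
    using e(1) by (rule order_tendstoD(2))
  then have "\<forall>\<^sub>F g in sequentially. real CARD('d) * (1 / 2^g) < e \<and> J \<le> g"
    using eventually_ge_at_top[of J] by eventually_elim blast
  then obtain g where g: "real CARD('d) * (1 / 2^g) < e" "J \<le> g"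
    unfolding eventually_sequentially by blast
  define u where "u = dyadic_index g y"
  have y01: "y \<in> open_cube01" using y W(2) by blast
  then have yc: "y \<in> closed_cube01" using open_cube01_subset_closed by blast
  have "u$i < 2^g" for i
  proof -
    have "2^g * y$i < 2^g * 1" using y01 unfolding open_cube01_def by (intro mult_strict_left_mono) auto
    then have "real (u$i) < 2^g" using dyadic_index_bounds(1)[OF yc, of g i] unfolding u_def by linarith
    then show ?thesis by (metis of_nat_less_iff of_nat_numeral of_nat_power)
  qed
  then have "valid_dyadic g u" unfolding valid_dyadic_def by blast
  moreover have "ccube g u \<subseteq> W"
  proof
    fix z assume "z \<in> ccube g u"
    then have "linf_dist y z \<le> 1 / 2^g" using mem_ccube_dyadic_index[OF yc] linf_dist_ccube unfolding u_def by blast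
    then have "real CARD('d) * linf_dist y z \<le> real CARD('d) * (1 / 2^g)" by (intro mult_left_mono) auto
    then have "z \<in> ball y e" using norm_le_linf_dist[of y z] g(1) by (simp add: dist_norm)
    then show "z \<in> W" using e(2) by blast
  qed
  ultimately show ?thesis using that g(2) by blast
qed

lemma Lf_exact_mono: "A \<subseteq> B \<Longrightarrow> Lf_exact x r A f \<subseteq> Lf_exact x r B f"
  unfolding Lf_exact_def by blast

lemma Lf_exact_subset_Lf: "Lf_exact x r A f \<subseteq> Lf x r A f"
  unfolding Lf_exact_def Lf_def by auto

section \<open>The approximation rate of the limit point\<close>

context C2_system
begin

text \<open>Compactness of \<open>{b..M}\<close> gives a uniform proportion of good cells as long as
  the exponents stay away from 1, where \<open>\<kappa>\<close> may degenerate.\<close>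

lemma \<kappa>_lower_bound:
  assumes "1 < b" "b \<le> M"
  shows "\<exists>k. 0 < k \<and> k \<le> 1 \<and> (\<forall>\<delta>. b \<le> \<delta> \<and> \<delta> \<le> M \<longrightarrow> k \<le> \<kappa> \<delta>)"
proof -
  have "continuous_on {b..M} \<kappa>" by (rule continuous_on_subset[OF \<kappa>_cont]) (use assms in auto)
  then obtain t where "t \<in> {b..M}" "\<And>\<delta>. \<delta> \<in> {b..M} \<Longrightarrow> \<kappa> t \<le> \<kappa> \<delta>"
    using continuous_attains_inf[of "{b..M}" \<kappa>] assms by auto
  then show ?thesis using \<kappa>_pos[of t] \<kappa>_le[of t] assms(1) by (intro exI[of _ "\<kappa> t"]) auto
qed

lemma tail_bound:
  assumes "0 < \<eta>" "0 < k"
  shows "\<exists>J\<ge>n. \<forall>g\<ge>J. \<forall>K. 2 * 64 ^ CARD('d) * (\<Sum>k\<in>{g..<K}. real (N k) * 2 powr (- (real CARD('d) * \<eta>) * real k)) \<le> k"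
proof -
  let ?C = "2 * (64::real) ^ CARD('d)"
  have "summable (\<lambda>k. real (N k) * 2 powr (- (real CARD('d) * \<eta>) * real k))"
    using assms by (intro C1_seq_summable[OF C1]) simp
  moreover have "0 < k / ?C" using assms by simp
  ultimately obtain J where J: "\<And>g K. g \<ge> J \<Longrightarrow>
      norm (\<Sum>k\<in>{g..<K}. real (N k) * 2 powr (- (real CARD('d) * \<eta>) * real k)) < k / ?C"
    unfolding summable_Cauchy by blast
  have "?C * (\<Sum>k\<in>{g..<K}. real (N k) * 2 powr (- (real CARD('d) * \<eta>) * real k)) \<le> k" if "g \<ge> J" for g K
  proof -
    have "(\<Sum>k\<in>{g..<K}. real (N k) * 2 powr (- (real CARD('d) * \<eta>) * real k)) \<le> k / ?C"
      using J[OF that, of K] by (simp only: real_norm_def)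
    then have "?C * (\<Sum>k\<in>{g..<K}. real (N k) * 2 powr (- (real CARD('d) * \<eta>) * real k)) \<le> ?C * (k / ?C)"
      by (intro mult_left_mono) auto
    then show ?thesis by simp
  qed
  then show ?thesis by (intro exI[of _ "max J n"]) auto
qed

text \<open>For any exponent below \<open>l\<close>, all late \<open>m n\<close> are witnesses of
  approximation. They need not be distinct, but their radii tend to 0, which finitely many positive
  radii cannot do.\<close>

lemma approx_rate_ge:
  assumes y: "y \<in> closed_cube01"
    and m: "\<And>n. r (m n) < 2 powr (- real n)" "\<And>n. linf_dist y (x (m n)) \<le> r (m n) powr \<delta> n"
    and lim: "\<delta> \<longlonglongrightarrow> l"
  shows "ereal l \<le> approx_rate x r y"
proof (rule ccontr)
  assume "\<not> ?thesis"
  then have "approx_rate x r y < ereal l" by simp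
  then obtain \<delta>' where d: "approx_rate x r y < ereal \<delta>'" "ereal \<delta>' < ereal l"
    using ereal_dense2 by blast
  have "0 \<le> approx_rate x r y" unfolding approx_rate_def by (rule Sup_upper) simp
  then have "0 < \<delta>'" using d(1) by (metis ereal_less(2) order_le_less_trans)
  have rpos: "\<And>n. 0 < r n" using sys unfolding is_system_def by auto
  have "\<forall>\<^sub>F n in sequentially. \<delta>' < \<delta> n" using d(2) by (intro order_tendstoD(1)[OF lim]) simp
  then obtain n0 where n0: "\<And>n. n \<ge> n0 \<Longrightarrow> \<delta>' < \<delta> n" unfolding eventually_sequentially by blast
  have inS: "linf_dist y (x (m n)) \<le> r (m n) powr \<delta>'" if "n \<ge> n0" for n
  proof -
    have "2 powr (- real n) \<le> (2::real) powr 0" by (intro powr_mono) auto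
    then have "r (m n) < 1" using m(1)[of n] by simp
    then have "r (m n) powr \<delta> n \<le> r (m n) powr \<delta>'" using n0[OF that] rpos[of "m n"] by (intro powr_mono') auto
    then show ?thesis using m(2)[of n] by simp
  qed
  have "infinite {n. linf_dist y (x n) \<le> r n powr \<delta>'}"
  proof
    assume fin: "finite {n. linf_dist y (x n) \<le> r n powr \<delta>'}" (is "finite ?S")
    define \<rho> where "\<rho> = Min (r ` ?S)"
    have "m n0 \<in> ?S" using inS by simp
    then have ne: "r ` ?S \<noteq> {}" by blast
    have "0 < \<rho>" unfolding \<rho>_def using fin ne rpos by (subst Min_gr_iff) auto
    moreover have "(\<lambda>n. 2 powr (- real n)) \<longlonglongrightarrow> 0" unfolding powr_real_eq_power by real_asymp
    ultimately have "\<forall>\<^sub>F n in sequentially. 2 powr (- real n) < \<rho>" by (rule order_tendstoD(2)[rotated])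
    then obtain n1 where n1: "\<And>n. n \<ge> n1 \<Longrightarrow> 2 powr (- real n) < \<rho>" unfolding eventually_sequentially by blast
    define n where "n = max n0 n1"
    have "m n \<in> ?S" using inS[of n] by (simp add: n_def)
    then have "\<rho> \<le> r (m n)" unfolding \<rho>_def using fin by (intro Min_le) auto
    then show False using m(1)[of n] n1[of n] by (simp add: n_def)
  qed
  then have "y \<in> L_set x r \<delta>'" using y unfolding L_set_def by simp
  then have "ereal \<delta>' \<le> approx_rate x r y" unfolding approx_rate_def using \<open>0 < \<delta>'\<close> by (intro Sup_upper) auto
  then show False using d(1) by simp
qed

text \<open>A rate above \<open>l\<close> would give late first occurrences \<open>p\<close> too
  close to \<open>y\<close>. With \<open>ell\<close> minus the binary logarithm of the radius, the
  stage is found where \<open>ell\<close> lies between two successive values of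
  \<open>gamma\<close>. Either the isolation at that stage or the avoidance at the next one keeps
  \<open>x p\<close> away from \<open>y\<close>.\<close>

lemma approx_rate_le:
  assumes y: "y \<notin> range x" and l: "1 \<le> l" and lim: "\<delta> \<longlonglongrightarrow> l" and \<eta>: "\<eta> \<longlonglongrightarrow> 0"
    and child: "\<And>n. good_child (\<eta> n) (\<delta> n) (G n) (Z n) (j n) (m n) (G (Suc n)) (Z (Suc n))"
    and jn: "\<And>n. n \<le> j n" and yZ: "\<And>n. y \<in> Z n"
  shows "approx_rate x r y \<le> ereal l"
proof (rule ccontr)
  let ?\<gamma> = "\<lambda>n. real (gamma CARD('d) N \<phi> (j n))"
  assume "\<not> ?thesis"
  then have "ereal l < approx_rate x r y" by simp
  then obtain \<delta>' where d: "ereal l < ereal \<delta>'" "ereal \<delta>' < approx_rate x r y"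
    using ereal_dense2 by blast
  have l\<delta>: "l < \<delta>'" and \<delta>0: "0 < \<delta>'" using d(1) l by auto
  have rpos: "\<And>n. 0 < r n" and rlim: "r \<longlonglongrightarrow> 0" using sys unfolding is_system_def by auto
  have "y \<in> L_set x r \<delta>'" by (rule approx_rate_lessD[OF sys \<delta>0 d(2)])
  then have inf: "infinite {p. first_occ x p \<and> linf_dist y (x p) \<le> r p powr \<delta>'}"
    by (intro infinite_first_occ[OF sys y \<delta>0]) (simp add: L_set_def)
  obtain \<beta> where \<beta>: "l < \<beta>" "\<beta> < \<delta>'" using dense[OF l\<delta>] by blast
  \<comment> \<open>This makes \<open>(1 - \<epsilon>) * \<delta>'\<close> the midpoint of
    \<open>\<beta>\<close> and \<open>\<delta>'\<close>, so that
    \<open>?\<gamma> n * \<delta>'\<close> still beats \<open>\<delta> n * (j n + 1) + 4\<close> for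
    large \<open>n\<close>.\<close>
  define \<epsilon> where "\<epsilon> = (\<delta>' - \<beta>) / (2 * \<delta>')"
  have \<epsilon>: "0 < \<epsilon>" "\<epsilon> < 1" "(1 - \<epsilon>) * \<delta>' = (\<delta>' + \<beta>) / 2"
    unfolding \<epsilon>_def using \<beta> l \<delta>0 by (auto simp: field_simps)
  have D1: "1 \<le> CARD('d)" by (simp add: Suc_leI)
  have jlim: "filterlim j at_top sequentially"
    using jn by (intro filterlim_at_top_mono[OF filterlim_ident]) auto
  have "\<forall>\<^sub>F k in sequentially. (1 - \<epsilon>) * real k - 1 \<le> real (gamma CARD('d) N \<phi> k)"
    using gamma_properties[OF Phi C1 D1 \<epsilon>(1,2)] by (rule eventually_mono) simp
  then have e1: "\<forall>\<^sub>F n in sequentially. (1 - \<epsilon>) * real (j n) - 1 \<le> ?\<gamma> n"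
    by (rule eventually_compose_filterlim[OF _ jlim])
  have "filterlim (\<lambda>k. ((\<delta>' - \<beta>) / 2) * real k) at_top sequentially"
    using \<beta> by (intro filterlim_tendsto_pos_mult_at_top[OF tendsto_const _ filterlim_real_sequentially]) simp
  then have "\<forall>\<^sub>F k in sequentially. \<beta> + 5 + \<delta>' \<le> ((\<delta>' - \<beta>) / 2) * real k"
    unfolding filterlim_at_top by blast
  then have e2: "\<forall>\<^sub>F n in sequentially. \<beta> + 5 + \<delta>' \<le> ((\<delta>' - \<beta>) / 2) * real (j n)"
    by (rule eventually_compose_filterlim[OF _ jlim])
  have e3: "\<forall>\<^sub>F n in sequentially. \<delta> n < \<beta>" by (rule order_tendstoD(2)[OF lim \<beta>(1)])
  have e4: "\<forall>\<^sub>F n in sequentially. \<eta> n < \<delta>' - 1" using l\<delta> l by (intro order_tendstoD(2)[OF \<eta>]) simp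
  have "\<forall>\<^sub>F n in sequentially. (1 - \<epsilon>) * real (j n) - 1 \<le> ?\<gamma> n \<and> \<delta> n * (real (j n) + 1) + 4 < ?\<gamma> n * \<delta>' \<and> 1 + \<eta> n \<le> \<delta>'"
    using e1 e2 e3 e4
  proof eventually_elim
    case (elim n)
    have "\<delta> n * (real (j n) + 1) \<le> \<beta> * (real (j n) + 1)" using elim(3) by (intro mult_right_mono) auto
    also have "\<dots> = \<beta> * real (j n) + \<beta>" by (simp add: algebra_simps)
    also have "\<dots> \<le> ((\<delta>' + \<beta>) / 2) * real (j n) - 5 - \<delta>'" using elim(2) by (simp add: field_simps)
    also have "\<dots> = ((1 - \<epsilon>) * real (j n) - 1) * \<delta>' - 5" unfolding \<epsilon>(3)[symmetric] by (simp add: algebra_simps)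
    also have "\<dots> \<le> ?\<gamma> n * \<delta>' - 5" using elim(1) \<delta>0 by (intro diff_right_mono mult_right_mono) auto
    finally show ?case using elim(1,4) by simp
  qed
  then obtain n0 where n0: "\<And>n. n \<ge> n0 \<Longrightarrow> (1 - \<epsilon>) * real (j n) - 1 \<le> ?\<gamma> n"
    "\<And>n. n \<ge> n0 \<Longrightarrow> \<delta> n * (real (j n) + 1) + 4 < ?\<gamma> n * \<delta>'" "\<And>n. n \<ge> n0 \<Longrightarrow> 1 + \<eta> n \<le> \<delta>'"
    unfolding eventually_sequentially by blast
  have "\<forall>\<^sub>F p in sequentially. r p < 2 powr (- ?\<gamma> n0)" by (intro order_tendstoD(2)[OF rlim]) simp
  then obtain p0 where p0: "\<And>p. p \<ge> p0 \<Longrightarrow> r p < 2 powr (- ?\<gamma> n0)" unfolding eventually_sequentially by blast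
  obtain p where p: "p \<ge> p0" "first_occ x p" "linf_dist y (x p) \<le> r p powr \<delta>'"
    using inf unfolding infinite_nat_iff_unbounded_le by blast
  define ell where "ell = - log 2 (r p)"
  have rp: "r p = 2 powr (- ell)" unfolding ell_def using rpos[of p] by simp
  have ell0: "?\<gamma> n0 \<le> ell" using p0[OF p(1)] unfolding rp by simp
  have "0 \<le> ell" using ell0 of_nat_0_le_iff[of "gamma CARD('d) N \<phi> (j n0)"] by linarith
  have ex: "\<exists>k. n0 \<le> k \<and> ell < ?\<gamma> (Suc k)"
  proof -
    obtain k where k: "(ell + 1) / (1 - \<epsilon>) < real k" using reals_Archimedean2 by blast
    define k' where "k' = max k n0"
    have "(ell + 1) / (1 - \<epsilon>) < real (j (Suc k'))" using k jn[of "Suc k'"] unfolding k'_def by linarith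
    then have "ell + 1 < (1 - \<epsilon>) * real (j (Suc k'))" using \<epsilon>(2) by (simp add: field_simps)
    moreover have "n0 \<le> Suc k'" unfolding k'_def by simp
    ultimately have "ell < ?\<gamma> (Suc k')" using n0(1)[of "Suc k'"] by linarith
    then show ?thesis unfolding k'_def by (intro exI[of _ "max k n0"]) simp
  qed
  \<comment> \<open>Minimality gives \<open>?\<gamma> n \<le> ell\<close>; for the first admissible
    index this holds because \<open>p\<close> was taken late.\<close>
  define n where "n = (LEAST k. n0 \<le> k \<and> ell < ?\<gamma> (Suc k))"
  have n: "n0 \<le> n" "ell < ?\<gamma> (Suc n)" using LeastI_ex[OF ex] unfolding n_def by auto
  have \<gamma>n: "?\<gamma> n \<le> ell"
  proof (cases "n = n0")
    case False
    then have "n - 1 < n" "n0 \<le> n - 1" "Suc (n - 1) = n" using n(1) by auto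
    then show ?thesis using not_less_Least[of "n - 1" "\<lambda>k. n0 \<le> k \<and> ell < ?\<gamma> (Suc k)"] unfolding n_def[symmetric] by auto
  qed (use ell0 in simp)
  show False
  proof (cases "ell < real_of_int \<lfloor>\<delta> n * (real (j n) + 1)\<rfloor> + 4")
    case True
    have "2 powr (- (\<delta> n * (real (j n) + 1) + 4)) \<le> linf_dist y (x p)"
      using child[of n] yZ[of "Suc n"] \<gamma>n True unfolding good_child_def ell_def by blast
    also have "\<dots> \<le> r p powr \<delta>'" by (rule p(3))
    also have "\<dots> = 2 powr (- (ell * \<delta>'))" unfolding rp by (simp add: powr_powr)
    also have "\<dots> \<le> 2 powr (- (?\<gamma> n * \<delta>'))" using \<gamma>n \<delta>0 by (intro powr_mono) (auto intro: mult_right_mono)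
    also have "\<dots> < 2 powr (- (\<delta> n * (real (j n) + 1) + 4))" using n0(2)[OF n(1)] by (intro powr_less_mono) auto
    finally show False by simp
  next
    case False
    \<comment> \<open>The child has generation at most the upper end of the isolation range, so the
      avoidance clause of the following stage takes over without a gap.\<close>
    have "real (G (Suc n)) \<le> ell" using child[of n] False unfolding good_child_def by linarith
    then have "r p powr (1 + \<eta> (Suc n)) < linf_dist y (x p)"
      using child[of "Suc n"] yZ[of "Suc (Suc n)"] p(2) n(2) unfolding good_child_def ell_def by blast
    also have "\<dots> \<le> r p powr \<delta>'" by (rule p(3))
    also have "\<dots> \<le> r p powr (1 + \<eta> (Suc n))"
    proof (rule powr_mono')
      show "1 + \<eta> (Suc n) \<le> \<delta>'" using n0(3)[of "Suc n"] n(1) by simp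
      show "0 \<le> r p" using rpos[of p] by simp
      have "2 powr (- ell) \<le> (2::real) powr 0" using \<open>0 \<le> ell\<close> by (intro powr_mono) auto
      then show "r p \<le> 1" unfolding rp by simp
    qed
    finally show False by simp
  qed
qed

text \<open>The cover is made to contain \<open>E\<close> and the centres as well, so the limit
  point it misses lies where \<open>f\<close> is continuous and the bound on the rate applies. The
  chosen exponents converge to the value of \<open>f\<close> there, so the rate is exactly this
  value, although the cover should have contained the point.\<close>

lemma not_null_covers_Lf_exact:
  assumes W: "open W" "W \<noteq> {}" "W \<subseteq> open_cube01"
    and fcont: "continuous_on (W - E) f" and f: "\<And>y. y \<in> W - E \<Longrightarrow> 1 \<le> f y" "\<And>y. y \<in> W - E \<Longrightarrow> f y < M"
    and M: "1 < M" and s: "0 < s" "s * M < real CARD('d)" and E: "null_covers s E"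
  shows "\<not> null_covers s (Lf_exact x r (W - E) f)"
proof
  assume "null_covers s (Lf_exact x r (W - E) f)"
  then have null: "null_covers s (Lf_exact x r (W - E) f \<union> (E \<union> range x))"
    by (intro null_covers_Un E null_covers_range s)
  \<comment> \<open>The floor \<open>b n\<close> keeps the exponents of stage \<open>n\<close> away
    from 1, so that \<open>k n\<close> can be fixed before any cube is known. It stays below
    \<open>1 + \<epsilon> n\<close>, which leaves room near every value of \<open>f\<close>, even
    1.\<close>
  define b where "b n = 1 + (M - 1) / (real n + 2)" for n :: nat
  define \<epsilon> where "\<epsilon> n = (M - 1) / (real n + 1)" for n :: nat
  define \<eta> where "\<eta> n = 1 / (real n + 1)" for n :: nat
  have b: "1 < b n" "b n < M" "b n < 1 + \<epsilon> n" for n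
  proof -
    show "1 < b n" unfolding b_def using M by simp
    have "(M - 1) / (real n + 2) < (M - 1) / 1" using M by (intro divide_strict_left_mono) auto
    then show "b n < M" unfolding b_def by simp
    have "(M - 1) / (real n + 2) < (M - 1) / (real n + 1)" using M by (intro divide_strict_left_mono) auto
    then show "b n < 1 + \<epsilon> n" unfolding b_def \<epsilon>_def by simp
  qed
  have \<eta>pos: "0 < \<eta> n" for n unfolding \<eta>_def by simp
  have "\<forall>n. \<exists>k. 0 < k \<and> k \<le> 1 \<and> (\<forall>\<delta>. b n \<le> \<delta> \<and> \<delta> \<le> M \<longrightarrow> k \<le> \<kappa> \<delta>)"
    using \<kappa>_lower_bound b less_imp_le by blast
  then obtain k where k: "\<And>n. 0 < k n" "\<And>n. k n \<le> 1" "\<And>n \<delta>. b n \<le> \<delta> \<Longrightarrow> \<delta> \<le> M \<Longrightarrow> k n \<le> \<kappa> \<delta>"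
    by metis
  have "\<forall>n. \<exists>J\<ge>Suc n. \<forall>g\<ge>J. \<forall>K. 2 * 64 ^ CARD('d) *
      (\<Sum>k\<in>{g..<K}. real (N k) * 2 powr (- (real CARD('d) * \<eta> n) * real k)) \<le> k n / 8"
    by (intro allI tail_bound \<eta>pos) (simp add: k(1))
  from choice[OF this] obtain J where J: "\<And>n. Suc n \<le> J n" "\<And>n g K. J n \<le> g \<Longrightarrow> 2 * 64 ^ CARD('d) *
      (\<Sum>k\<in>{g..<K}. real (N k) * 2 powr (- (real CARD('d) * \<eta> n) * real k)) \<le> k n / 8"
    by blast
  define c where "c n = k n / (16 * 4 ^ CARD('d))" for n
  have c: "0 < c n" "c n \<le> 1" for n
  proof -
    show "0 < c n" unfolding c_def using k(1) by simp
    have "1 \<le> 16 * (4::real) ^ CARD('d)" using one_le_power[of "4::real" "CARD('d)"] by linarith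
    then show "c n \<le> 1" unfolding c_def using k(2)[of n] by (simp add: field_simps)
  qed
  obtain g0 u0 where g0: "J 0 \<le> g0" "valid_dyadic g0 u0" "ccube g0 u0 \<subseteq> W"
    by (rule open_contains_ccube[OF W(1,3,2)]) blast
  have "0 < c 0 * 2 powr (- real g0 * s)" using c by simp
  then obtain A a where A: "Lf_exact x r (W - E) f \<union> (E \<union> range x) \<subseteq> \<Union>(range A)" "\<And>i. 0 < a i"
    "\<And>i y z. y \<in> A i \<Longrightarrow> z \<in> A i \<Longrightarrow> linf_dist y z \<le> a i"
    "summable (\<lambda>i. a i powr s)" "(\<Sum>i. a i powr s) < c 0 * 2 powr (- real g0 * s)"
    by (rule null_coversD[OF null]) blast
  have "s * 1 \<le> s * M" using s M by (intro mult_left_mono) auto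
  then have "s \<le> real CARD('d)" using s by linarith
  then have cov: "small_cover A a s" using A s by unfold_locales
  interpret small_cover A a s by (rule cov)
  define Inv where "Inv n st \<longleftrightarrow> J n \<le> fst st \<and> valid_dyadic (fst st) (snd st) \<and> ccube (fst st) (snd st) \<subseteq> ccube g0 u0 \<and>
      hitting_sum A a s (ccube (fst st) (snd st)) < c n * 2 powr (- real (fst st) * s)" for n and st :: "nat \<times> (nat^'d)"
  \<comment> \<open>A cube contained in \<open>E\<close> offers no value of \<open>f\<close>, hence
    the implication; its premise is verified afterwards, once the limit point is known to lie
    outside \<open>E\<close>.\<close>
  define Rel where "Rel n st st' \<longleftrightarrow> (\<exists>\<delta> j m. n \<le> j \<and>
      (ccube (fst st) (snd st) - E \<noteq> {} \<longrightarrow> (\<exists>p\<in>ccube (fst st) (snd st) - E. \<bar>\<delta> - f p\<bar> < \<epsilon> n)) \<and>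
      good_child (\<eta> n) \<delta> (fst st) (ccube (fst st) (snd st)) j m (fst st') (ccube (fst st') (snd st')))"
    for n and st st' :: "nat \<times> (nat^'d)"
  have start: "Inv 0 (g0, u0)"
    unfolding Inv_def using g0 A(5) hitting_sum_le[of "ccube g0 u0"] by simp
  have step: "\<exists>st'. Inv (Suc n) st' \<and> Rel n st st'" if I: "Inv n st" for n st
  proof -
    obtain g u where st: "st = (g, u)" by (cases st)
    have I': "J n \<le> g" "valid_dyadic g u" "ccube g u \<subseteq> ccube g0 u0"
      "hitting_sum A a s (ccube g u) < c n * 2 powr (- real g * s)"
      using I unfolding Inv_def st by auto
    define p where "p = (SOME p. p \<in> ccube g u - E)"
    have p: "p \<in> ccube g u - E" if "ccube g u - E \<noteq> {}"
      unfolding p_def by (rule someI_ex) (use that in blast)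
    \<comment> \<open>The target of the exponent is a value of \<open>f\<close> in the cube, or the
      default 1 if the cube lies in \<open>E\<close>.\<close>
    define t where "t = (if ccube g u - E \<noteq> {} then f p else 1)"
    have t: "1 \<le> t" "t < M" using p f[of p] I'(3) g0(3) M unfolding t_def by auto
    define I where "I = {max (b n) (t - \<epsilon> n)<..<min M (t + \<epsilon> n)}"
    have "0 < \<epsilon> n" unfolding \<epsilon>_def using M by simp
    then have "max (b n) (t - \<epsilon> n) < min M (t + \<epsilon> n)" using b[of n] t by auto
    from dense[OF this] obtain z where z: "z \<in> I" unfolding I_def greaterThanLessThan_iff by blast
    then have "z \<in> closure \<Delta>" using b(1)[of n] \<Delta>(2) unfolding I_def by auto
    then have "I \<inter> closure \<Delta> \<noteq> {}" using z by blast
    moreover have "open I" unfolding I_def by simp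
    ultimately have "I \<inter> \<Delta> \<noteq> {}" using open_Int_closure_eq_empty by blast
    then obtain \<delta> where \<delta>: "\<delta> \<in> \<Delta>" "\<delta> \<in> I" by blast
    then have \<delta>': "b n \<le> \<delta>" "\<delta> \<le> M" "\<bar>\<delta> - t\<bar> < \<epsilon> n" unfolding I_def by auto
    have "1 \<le> g" using I'(1) J(1)[of n] by simp
    obtain j m g' u' where w: "J (Suc n) \<le> j" "valid_dyadic g' u'"
      "good_child (\<eta> n) \<delta> g (ccube g u) j m g' (ccube g' u')"
      "hitting_sum A a s (ccube g' u') < c (Suc n) * 2 powr (- real g' * s)"
      using good_child_exists[OF cov s(2) \<delta>(1) \<delta>'(2) k(1)[of n] k(3)[OF \<delta>'(1,2)] \<eta>pos[of n] c(1)[of "Suc n"]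
          \<open>1 \<le> g\<close> I'(2) J(2)[OF I'(1)] I'(4)[unfolded c_def], of "J (Suc n)"] by blast
    have "Inv (Suc n) (g', u')"
      unfolding Inv_def using w I'(3) unfolding good_child_def by auto
    moreover have "Rel n st (g', u')"
      unfolding Rel_def st fst_conv snd_conv
    proof (intro exI conjI impI)
      show "n \<le> j" using J(1)[of "Suc n"] w(1) by simp
      show "\<exists>p\<in>ccube g u - E. \<bar>\<delta> - f p\<bar> < \<epsilon> n" if "ccube g u - E \<noteq> {}"
        using \<delta>'(3) p[OF that] that unfolding t_def by (intro bexI[of _ p]) simp_all
    qed (rule w(3))
    ultimately show ?thesis by blast
  qed
  obtain S where S: "\<And>n. Inv n (S n)" "\<And>n. Rel n (S n) (S (Suc n))"
    using dependent_nat_choice[of Inv Rel] start step by blast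
  define G where "G n = fst (S n)" for n
  define Z where "Z n = ccube (fst (S n)) (snd (S n))" for n
  have G: "J n \<le> G n" "Z n \<subseteq> ccube g0 u0" "hitting_sum A a s (Z n) < c n * 2 powr (- real (G n) * s)" for n
    using S(1)[of n] unfolding Inv_def G_def Z_def by auto
  have Gn: "n \<le> G n" for n using G(1)[of n] J(1)[of n] by simp
  have "\<forall>n. \<exists>\<delta> j m. n \<le> j \<and> (Z n - E \<noteq> {} \<longrightarrow> (\<exists>p\<in>Z n - E. \<bar>\<delta> - f p\<bar> < \<epsilon> n)) \<and>
      good_child (\<eta> n) \<delta> (G n) (Z n) j m (G (Suc n)) (Z (Suc n))"
    using S(2) unfolding Rel_def G_def Z_def by blast
  then obtain \<delta> j m where R: "\<And>n. n \<le> j n"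
    "\<And>n. Z n - E \<noteq> {} \<Longrightarrow> \<exists>p\<in>Z n - E. \<bar>\<delta> n - f p\<bar> < \<epsilon> n"
    "\<And>n. good_child (\<eta> n) (\<delta> n) (G n) (Z n) (j n) (m n) (G (Suc n)) (Z (Suc n))"
    by metis
  have Zdec: "Z n \<subseteq> Z n'" if "n' \<le> n" for n n'
    using that by (rule lift_Suc_antimono_le[of Z, rotated]) (use R(3) in \<open>auto simp: good_child_def\<close>)
  have "\<Inter>(range Z) \<noteq> {}"
  proof (rule compact_nest)
    show "compact (Z n)" "Z n \<noteq> {}" for n
      unfolding Z_def using compact_ccube corner_mem_ccube by blast+
  qed (rule Zdec)
  then obtain y where y: "\<And>n. y \<in> Z n" by blast
  have yA: "y \<notin> A i" for i
  proof
    assume "y \<in> A i"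
    \<comment> \<open>If \<open>y\<close> were in \<open>A i\<close>, every hitting sum would be at
      least the fixed positive weight of \<open>A i\<close>, while the invariant forces these sums
      to 0.\<close>
    have lt: "a i powr s < 2 powr (- s * real n)" for n
    proof -
      have "a i powr s \<le> hitting_sum A a s (Z n)" using \<open>y \<in> A i\<close> y[of n] by (intro hit_le_hitting_sum) blast
      also have "\<dots> < c n * 2 powr (- real (G n) * s)" by (rule G(3))
      also have "\<dots> \<le> 1 * 2 powr (- s * real n)"
      proof (rule mult_mono)
        have "s * real n \<le> s * real (G n)" using Gn[of n] s by (intro mult_left_mono) auto
        then show "2 powr (- real (G n) * s) \<le> 2 powr (- s * real n)"
          by (intro powr_mono) (auto simp: mult.commute)
      qed (use c[of n] in auto)
      finally show ?thesis by simp
    qed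
    have "(\<lambda>n. 2 powr (- s * real n)) \<longlonglongrightarrow> 0" using s by real_asymp
    moreover have "0 < a i powr s" using a_pos[of i] by simp
    ultimately have "\<forall>\<^sub>F n in sequentially. 2 powr (- s * real n) < a i powr s" by (rule order_tendstoD(2))
    then obtain n where "2 powr (- s * real n) < a i powr s" unfolding eventually_sequentially by blast
    then show False using lt[of n] by simp
  qed
  have yW: "y \<in> W" using y[of 0] G(2) g0(3) by blast
  have yE: "y \<notin> E" and yx: "y \<notin> range x" and yL: "y \<notin> Lf_exact x r (W - E) f" using yA A(1) by blast+
  \<comment> \<open>As \<open>y\<close> itself lies in every cube and outside \<open>E\<close>, each
    stage has a sample point; these converge to \<open>y\<close> and carry the exponents to
    \<open>f y\<close>.\<close>
  have "\<forall>n. \<exists>p. p \<in> Z n - E \<and> \<bar>\<delta> n - f p\<bar> < \<epsilon> n" using R(2) y yE by blast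
  then obtain p where p: "\<And>n. p n \<in> Z n - E" "\<And>n. \<bar>\<delta> n - f (p n)\<bar> < \<epsilon> n" by metis
  have plim: "p \<longlonglongrightarrow> y"
  proof (rule metric_tendsto_imp_tendsto)
    show "(\<lambda>n. real CARD('d) * (1 / 2^n)) \<longlonglongrightarrow> (0::real)" by real_asymp
    show "\<forall>\<^sub>F n in sequentially. dist (p n) y \<le> dist (real CARD('d) * (1 / 2^n)) (0::real)"
    proof (intro always_eventually allI)
      fix n
      have "linf_dist (p n) y \<le> 1 / 2^(G n)"
        using p(1)[of n] y[of n] unfolding Z_def G_def by (intro linf_dist_ccube) auto
      also have "\<dots> \<le> 1 / 2^n" using Gn[of n] by (intro divide_left_mono power_increasing) auto
      finally have "real CARD('d) * linf_dist (p n) y \<le> real CARD('d) * (1 / 2^n)" by (intro mult_left_mono) auto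
      then show "dist (p n) y \<le> dist (real CARD('d) * (1 / 2^n)) (0::real)"
        using norm_le_linf_dist[of "p n" y] by (simp add: dist_norm)
    qed
  qed
  have "(\<lambda>n. f (p n)) \<longlonglongrightarrow> f y"
    by (rule continuous_on_tendsto_compose[OF fcont plim])
      (use p(1) G(2) g0(3) yW yE in \<open>auto intro!: always_eventually\<close>)
  moreover have "(\<lambda>n. \<delta> n - f (p n)) \<longlonglongrightarrow> 0"
  proof (rule Lim_null_comparison)
    show "\<forall>\<^sub>F n in sequentially. norm (\<delta> n - f (p n)) \<le> \<epsilon> n" using p(2) by (auto intro!: always_eventually less_imp_le)
    show "\<epsilon> \<longlonglongrightarrow> 0" unfolding \<epsilon>_def by real_asymp
  qed
  ultimately have "(\<lambda>n. (\<delta> n - f (p n)) + f (p n)) \<longlonglongrightarrow> 0 + f y" by (intro tendsto_add)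
  then have \<delta>lim: "\<delta> \<longlonglongrightarrow> f y" by simp
  have "ereal (f y) \<le> approx_rate x r y"
  proof (rule approx_rate_ge[OF _ _ _ \<delta>lim])
    show "y \<in> closed_cube01" using yW W(3) open_cube01_subset_closed by blast
    fix n
    have "r (m n) < 2 powr (- real (j n))" using R(3)[of n] unfolding good_child_def by blast
    also have "\<dots> \<le> 2 powr (- real n)" using R(1)[of n] by (intro powr_mono) auto
    finally show "r (m n) < 2 powr (- real n)" .
    show "linf_dist y (x (m n)) \<le> r (m n) powr \<delta> n"
      using R(3)[of n] y[of "Suc n"] unfolding good_child_def by blast
  qed
  moreover have "approx_rate x r y \<le> ereal (f y)"
  proof (rule approx_rate_le[OF yx _ \<delta>lim _ R(3) R(1) y])
    show "1 \<le> f y" using f(1) yW yE by blast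
    show "\<eta> \<longlonglongrightarrow> 0" unfolding \<eta>_def by real_asymp
  qed
  ultimately have "approx_rate x r y = ereal (f y)" by (rule antisym[rotated])
  then show False using yL yW yE unfolding Lf_exact_def by blast
qed

end

section \<open>From null covers to Hausdorff dimension\<close>

lemma hdim_le:
  assumes "0 < s" "null_covers s A"
  shows "hdim A \<le> s"
  unfolding hdim_def using assms null_covers_iff_hausdorff_measure
  by (intro cInf_lower) (auto intro: bdd_belowI[of _ 0])

lemma hdim_nonneg: "0 < t \<Longrightarrow> null_covers t A \<Longrightarrow> 0 \<le> hdim A"
  unfolding hdim_def using null_covers_iff_hausdorff_measure
  by (intro cInf_greatest) auto

text \<open>The known exponent \<open>t\<close> makes the set in \<open>hdim\<close> non-empty, so
  the infimum is approached by admissible exponents, and monotonicity in the exponent does the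
  rest.\<close>

lemma null_covers_if_hdim_less:
  assumes t: "0 < t" "null_covers t A" and s: "hdim A < s"
  shows "null_covers s A"
proof -
  have "{s. 0 < s \<and> hausdorff_measure s A = 0} \<noteq> {}" using t null_covers_iff_hausdorff_measure by blast
  then obtain s' where "0 < s'" "hausdorff_measure s' A = 0" "s' < s"
    using cInf_lessD[OF _ s[unfolded hdim_def]] by blast
  then show ?thesis using null_covers_mono[of s' A s] null_covers_iff_hausdorff_measure[of s' A] by simp
qed

theorem theorem2:
  fixes x :: "nat \<Rightarrow> real^'d" and r :: "nat \<Rightarrow> real"
    and \<Omega> E :: "(real^'d) set" and f :: "real^'d \<Rightarrow> real"
  assumes "is_system x r"
    and "\<forall>n. x n \<in> open_cube01"
    and "{y. infinite {n. y \<in> ball_inf (x n) (r n)}} = open_cube01"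
    and "C1 x r" and "C2 x r"
    and "compact \<Omega>" and "\<Omega> \<noteq> {}" and "\<Omega> \<subseteq> open_cube01"
    and "closure (interior \<Omega>) = \<Omega>"
    and "E \<subseteq> \<Omega>"
    and "\<forall>y\<in>open_cube01. 1 \<le> f y"
    and "continuous_on (\<Omega> - E) f"
    and "ereal (hdim E) < ereal (real CARD('d)) / Inf (ereal ` f ` (\<Omega> - E))"
  shows "ereal (hdim (Lf x r (\<Omega> - E) f)) = ereal (real CARD('d)) / Inf (ereal ` f ` (\<Omega> - E))
       \<and> ereal (hdim (Lf_exact x r (\<Omega> - E) f)) = ereal (real CARD('d)) / Inf (ereal ` f ` (\<Omega> - E))
       \<and> (ereal (hdim E) < ereal (real CARD('d)) / Sup (ereal ` f ` (\<Omega> - E)) \<longrightarrow>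
            \<Omega> \<subseteq> closure (Lf x r (\<Omega> - E) f) \<and> \<Omega> \<subseteq> closure (Lf_exact x r (\<Omega> - E) f))"
proof -
  note sys = assms(1) and \<Omega>cube = assms(8) and \<Omega>cl = assms(9) and fcont = assms(12)
  let ?D = "real CARD('d)" and ?L = "Lf x r (\<Omega> - E) f" and ?Le = "Lf_exact x r (\<Omega> - E) f"
  have D: "0 < ?D" by simp
  obtain \<phi> N \<kappa> \<Delta> where C2: "In_Phi \<phi>" "C1_seq x r N"
     "continuous_on {1<..} \<kappa>" "\<forall>\<delta>>1. 0 < \<kappa> \<delta> \<and> \<kappa> \<delta> \<le> 1"
     "\<Delta> \<subseteq> {1<..}" "{1<..} \<subseteq> closure \<Delta>"
     "\<forall>\<delta>\<in>\<Delta>. \<forall>gU (kU::nat^'d). gU \<ge> 1 \<and> valid_dyadic gU kU \<longrightarrow>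
        infinite {j. gU \<le> j \<and>
          real (card (Q_set x r N \<phi> gU kU j \<delta>)) \<ge> \<kappa> \<delta> * 2 powr (real CARD('d) * (real j - real gU))}"
    using assms(5) unfolding C2_def by (elim exE conjE) rule
  interpret C2_system x r \<phi> N \<kappa> \<Delta> using sys C2 by unfold_locales auto
  \<comment> \<open>Every subset of the cube is null for the exponent dimension plus 1, so the
    infimum in \<open>hdim\<close> is never over an empty set.\<close>
  have "(open_cube01 :: (real^'d) set) \<subseteq> L_set x r 1"
  proof
    fix y :: "real^'d" assume y: "y \<in> open_cube01"
    then have "infinite {n. y \<in> ball_inf (x n) (r n)}" using assms(3) by blast
    moreover have "0 < r n" for n using sys unfolding is_system_def by blast
    ultimately show "y \<in> L_set x r 1"
      using y open_cube01_subset_closed unfolding L_set_def ball_inf_def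
      by (auto simp: linf_dist_commute less_imp_le)
  qed
  moreover have "null_covers (?D + 1) (L_set x r 1)" by (rule null_covers_L_set[OF sys C2(2)]) auto
  ultimately have cubenull: "null_covers (?D + 1) A" if "A \<subseteq> open_cube01" for A :: "(real^'d) set"
    using that null_covers_subset by (meson order_trans)
  have D1: "0 < ?D + 1" by simp
  have dim_nn: "0 \<le> hdim A" if "A \<subseteq> open_cube01" for A :: "(real^'d) set" by (rule hdim_nonneg[OF D1 cubenull[OF that]])
  have dim_null: "null_covers s A" if "A \<subseteq> open_cube01" "hdim A < s" for A :: "(real^'d) set" and s
    by (rule null_covers_if_hdim_less[OF D1 cubenull[OF that(1)] that(2)])
  have Ecube: "E \<subseteq> open_cube01" using assms(8,10) by blast
  have Lcube: "?L \<subseteq> open_cube01" "?Le \<subseteq> open_cube01" using \<Omega>cube unfolding Lf_def Lf_exact_def by auto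
  have f1: "1 \<le> f y" if "y \<in> \<Omega> - E" for y using that assms(8,11) by blast
  \<comment> \<open>Over an empty set the infimum is infinite and the quotient is 0, contradicting
    that \<open>hdim E\<close> is non-negative.\<close>
  have ne: "\<Omega> - E \<noteq> {}"
  proof
    assume "\<Omega> - E = {}"
    then have "ereal (hdim E) < 0" using assms(13) unfolding \<open>\<Omega> - E = {}\<close> by (simp add: top_ereal_def)
    then show False using dim_nn[OF Ecube] by simp
  qed
  then obtain y1 where y1: "y1 \<in> \<Omega> - E" by blast
  define h where "h = Inf (f ` (\<Omega> - E))"
  have bdd: "bdd_below (f ` (\<Omega> - E))" using f1 by (intro bdd_belowI[of _ 1]) auto
  have Inf_h: "Inf (ereal ` f ` (\<Omega> - E)) = ereal h"
    unfolding h_def using ereal_Inf'[OF bdd] ne by simp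
  have h1: "1 \<le> h" unfolding h_def using ne f1 by (intro cInf_greatest) auto
  have hf: "h \<le> f y" if "y \<in> \<Omega> - E" for y unfolding h_def using bdd that by (intro cInf_lower) auto
  have dimE: "hdim E < ?D / h" using assms(13) h1 unfolding Inf_h by simp
  have "hdim ?L \<le> ?D / h"
  proof (rule dense_ge)
    fix t assume t: "?D / h < t"
    have "0 < ?D / h" using h1 by simp
    then have "0 < t" using t by linarith
    then show "hdim ?L \<le> t"
      using h1 by (intro hdim_le null_covers_Lf[OF sys C2(2) _ t hf]) auto
  qed
  moreover have "hdim ?Le \<le> hdim ?L"
  proof (rule dense_ge)
    fix t assume t: "hdim ?L < t"
    then have "0 < t" using dim_nn[OF Lcube(1)] by simp
    then show "hdim ?Le \<le> t"
      using null_covers_subset[OF dim_null[OF Lcube(1) t] Lf_exact_subset_Lf] by (rule hdim_le)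
  qed
  \<comment> \<open>The interior is dense in \<open>\<Omega>\<close>, so an open \<open>T\<close>
    meeting \<open>\<Omega>\<close> meets it as well and the construction can run inside the
    intersection.\<close>
  moreover have main: "\<not> null_covers s (Lf_exact x r (T \<inter> interior \<Omega> - E) f)"
    if T: "open T" "T \<inter> \<Omega> \<noteq> {}" "\<And>y. y \<in> T \<inter> interior \<Omega> - E \<Longrightarrow> f y < M" "1 < M"
      and s: "hdim E < s" "s * M < ?D" for T M s
  proof (rule not_null_covers_Lf_exact[OF _ _ _ _ _ T(3,4) _ s(2)])
    show "open (T \<inter> interior \<Omega>)" by (intro open_Int open_interior T(1))
    show "T \<inter> interior \<Omega> \<noteq> {}" using T(2) open_Int_closure_eq_empty[OF T(1), of "interior \<Omega>"] unfolding \<Omega>cl by simp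
    show "T \<inter> interior \<Omega> \<subseteq> open_cube01" using interior_subset \<Omega>cube by blast
    have sub: "T \<inter> interior \<Omega> - E \<subseteq> \<Omega> - E" using interior_subset by blast
    show "continuous_on (T \<inter> interior \<Omega> - E) f" by (rule continuous_on_subset[OF fcont sub])
    show "1 \<le> f y" if "y \<in> T \<inter> interior \<Omega> - E" for y using f1 sub that by blast
    show "0 < s" using s(1) dim_nn[OF Ecube] by linarith
    show "null_covers s E" by (rule dim_null[OF Ecube s(1)])
  qed
  moreover have "?D / h \<le> hdim ?Le"
  proof (rule ccontr)
    assume "\<not> ?thesis"
    then have "max (hdim ?Le) (hdim E) < ?D / h" using dimE by simp
    then obtain s where s: "hdim ?Le < s" "hdim E < s" "s < ?D / h" using dense by (metis max_less_iff_conj)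
    have s0: "0 < s" using s(2) dim_nn[OF Ecube] by linarith
    have "h < ?D / s" using s(3) s0 h1 by (simp add: field_simps)
    \<comment> \<open>The gap between \<open>h\<close> and \<open>?D / s\<close> leaves room for a
      bound \<open>M\<close> that \<open>f\<close> respects near some point of
      \<open>\<Omega> - E\<close>; the relatively open set where \<open>f\<close> is below
      \<open>M\<close> supplies \<open>T\<close>.\<close>
    then obtain M where M: "h < M" "M < ?D / s" using dense by blast
    have "s * M < ?D" using M(2) s0 by (simp add: field_simps)
    obtain y0 where y0: "y0 \<in> \<Omega> - E" "f y0 < M"
      using cInf_lessD[of "f ` (\<Omega> - E)" M] M(1) ne unfolding h_def by auto
    obtain T where T: "open T" "T \<inter> (\<Omega> - E) = f -` {..<M} \<inter> (\<Omega> - E)"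
      using fcont unfolding continuous_on_open_invariant by (metis open_lessThan)
    have "\<not> null_covers s (Lf_exact x r (T \<inter> interior \<Omega> - E) f)"
    proof (rule main[OF T(1) _ _ _ s(2) \<open>s * M < ?D\<close>])
      show "T \<inter> \<Omega> \<noteq> {}" using T(2) y0 by blast
      show "f y < M" if "y \<in> T \<inter> interior \<Omega> - E" for y using that T(2) interior_subset by blast
      show "1 < M" using M(1) h1 by simp
    qed
    moreover have "Lf_exact x r (T \<inter> interior \<Omega> - E) f \<subseteq> ?Le" using interior_subset by (intro Lf_exact_mono) blast
    ultimately show False using dim_null[OF Lcube(2) s(1)] null_covers_subset by blast
  qed
  ultimately have dims: "hdim ?L = ?D / h" "hdim ?Le = ?D / h" by linarith+
  have dense: "\<Omega> \<subseteq> closure ?Le" if dimS: "ereal (hdim E) < ereal ?D / Sup (ereal ` f ` (\<Omega> - E))"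
  proof (rule subsetI, rule ccontr)
    fix y assume y: "y \<in> \<Omega>" "y \<notin> closure ?Le"
    let ?S = "Sup (ereal ` f ` (\<Omega> - E))"
    have fS: "ereal (f z) \<le> ?S" if "z \<in> \<Omega> - E" for z using that by (intro Sup_upper) auto
    have S1: "1 \<le> ?S" using fS[OF y1] f1[OF y1] 
      by (intro order_trans[OF _ fS[OF y1]]) (simp add: one_ereal_def)
    \<comment> \<open>An infinite supremum would make the quotient 0, while \<open>hdim E\<close> is
      non-negative.\<close>
    have "?S \<noteq> \<infinity>" using dimS dim_nn[OF Ecube] by auto
    then obtain \<sigma> where \<sigma>: "?S = ereal \<sigma>" using S1 by (cases ?S) auto
    have \<sigma>1: "1 \<le> \<sigma>" using S1 unfolding \<sigma> by simp
    have "hdim E < ?D / \<sigma>" using dimS \<sigma>1 unfolding \<sigma> by simp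
    then obtain s where s: "hdim E < s" "s < ?D / \<sigma>" using dense by blast
    have s0: "0 < s" using s(1) dim_nn[OF Ecube] by linarith
    have "\<sigma> < ?D / s" using s(2) s0 \<sigma>1 by (simp add: field_simps)
    then obtain M where M: "\<sigma> < M" "M < ?D / s" using dense by blast
    have "s * M < ?D" using M(2) s0 by (simp add: field_simps)
    \<comment> \<open>Here \<open>M\<close> bounds \<open>f\<close> on all of
      \<open>\<Omega> - E\<close>, so \<open>T\<close> may be the complement of the closure, which
      meets \<open>\<Omega>\<close> at \<open>y\<close>. It contains no point of \<open>?Le\<close>,
      and the empty set is null.\<close>
    have "\<not> null_covers s (Lf_exact x r (- closure ?Le \<inter> interior \<Omega> - E) f)"
    proof (rule main[OF _ _ _ _ s(1) \<open>s * M < ?D\<close>])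
      show "- closure ?Le \<inter> \<Omega> \<noteq> {}" using y by blast
      show "f z < M" if "z \<in> - closure ?Le \<inter> interior \<Omega> - E" for z
        using that fS[of z] interior_subset[of \<Omega>] M(1) unfolding \<sigma> by auto
      show "1 < M" using M(1) \<sigma>1 by simp
      show "open (- closure ?Le)" by (intro open_Compl closed_closure)
    qed
    moreover have "Lf_exact x r (- closure ?Le \<inter> interior \<Omega> - E) f \<subseteq> {}"
    proof
      fix z assume z: "z \<in> Lf_exact x r (- closure ?Le \<inter> interior \<Omega> - E) f"
      then have "z \<in> ?Le" using interior_subset unfolding Lf_exact_def by blast
      then have "z \<in> closure ?Le" using closure_subset by blast
      then show "z \<in> {}" using z unfolding Lf_exact_def by blast
    qed
    ultimately show False using dim_null[OF Ecube s(1)] null_covers_subset by blast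
  qed
  have "closure ?Le \<subseteq> closure ?L" by (intro closure_mono Lf_exact_subset_Lf)
  then show ?thesis using dims dense h1 unfolding Inf_h by auto
qed

end
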